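(* Let $S=1-T$ and let $A\in A_{\mathrm{inf}}$ be the element such that $[T^{\flat}] + [S^{\flat}] - 1 = A\,([p^{\flat}]-p)$. Then there exists a sequence $(a_1,a_2,\dots)$ with $a_n\in \mathbb{Z}[p^{1/p^{n-1}},T^{1/p^n},S^{1/p^n}]$ such that $$\theta(A) \equiv a_n \pmod{p^n}$$ (congruence in $\mathcal{O}_K$) for each integer $n\ge 1$.
   Context: $p$ is a fixed prime. $K_0$ is the completion of $\mathbb{Q}_p(T)$ for the discrete valuation with valuation ring $\mathbb{Z}_p[T]_{(p)}$; $\bar K_0$ is an algebraic closure of $K_0$ with the extended valuation; $K$ is the completion of $\bar K_0$; $\mathcal{O}_K$ is its valuation ring. For $X\in\{p,T,S\}$ fix a compatible system of $p$-power roots $X^{1/p^n}\in\mathcal{O}_{\bar K_0}$, $(X^{1/p^n})^p=X^{1/p^{n-1}}$. $\mathcal{O}_{K^\flat}:=\varprojlim_{x\mapsto x^p}\mathcal{O}_K/p$, and $X^\flat:=(X,X^{1/p},X^{1/p^2},\dots)\in\mathcal{O}_{K^\flat}$ (reductions mod $p$). For $n\ge 0$ the multiplicative map $(\ )^{\sharp_n}:\mathcal{O}_{K^\flat}\to\mathcal{O}_K$ is $(\bar x_0,\bar x_1,\dots)\mapsto\lim_{k\ge n}x_k^{p^{k-n}}$, where $x_k\in\mathcal{O}_K$ is any lift of $\bar x_k$. $A_{\mathrm{inf}}:=W(\mathcal{O}_{K^\flat})$ is the ring of $p$-typical Witt vectors, $[a]=(a,0,0,\dots)$ is the Teichmüller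 representative, and Fontaine's map $\theta:A_{\mathrm{inf}}\to\mathcal{O}_K$ is the ring homomorphism $(x_0,x_1,\dots)\mapsto\sum_{n\ge 0}p^n x_n^{\sharp_n}$; its kernel is generated by $[p^\flat]-p$. *)

theory Defs
  imports
    "HOL-Analysis.Abstract_Metric_Spaces"
    "HOL-Computational_Algebra.Primes"
    "HOL-Library.Poly_Mapping"
    "HOL-Algebra.Algebra"
    "HOL-Algebra.Algebraic_Closure_Type"
begin

text \<open>
  The field \<open>K\<close> is a type \<open>'k\<close> of class \<^class>\<open>field_char_0\<close> with an absolute value
  \<open>v :: 'k \<Rightarrow> real\<close>; the smaller fields are subsets of it. The derived rings (\<open>O\<^sub>K\<close>, its
  quotient by \<open>p\<close>, the tilt, the Witt vectors) are HOL-Algebra records, and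
  \<^const>\<open>ring_of_type_algebra\<close> is \<open>K\<close> itself as such a record.
\<close>

abbreviation fld :: "'k::field_char_0 ring"
  where "fld \<equiv> ring_of_type_algebra"

section \<open>The fields\<close>

definition nonarch_abs :: "('k::field_char_0 \<Rightarrow> real) \<Rightarrow> bool"
  where "nonarch_abs v \<longleftrightarrow>
    (\<forall>x. 0 \<le> v x) \<and> (\<forall>x. v x = 0 \<longleftrightarrow> x = 0) \<and>
    (\<forall>x y. v (x * y) = v x * v y) \<and> (\<forall>x y. v (x + y) \<le> max (v x) (v y))"

definition vdist :: "('k::field_char_0 \<Rightarrow> real) \<Rightarrow> 'k \<Rightarrow> 'k \<Rightarrow> real"
  where "vdist v x y = v (x - y)"

definition vtendsto :: "('k::field_char_0 \<Rightarrow> real) \<Rightarrow> (nat \<Rightarrow> 'k) \<Rightarrow> 'k \<Rightarrow> bool"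
  where "vtendsto v s l \<longleftrightarrow> limitin (Metric_space.mtopology UNIV (vdist v)) s l sequentially"

definition vlim :: "('k::field_char_0 \<Rightarrow> real) \<Rightarrow> (nat \<Rightarrow> 'k) \<Rightarrow> 'k"
  where "vlim v s = (THE l. vtendsto v s l)"

definition completion_of :: "('k::field_char_0 \<Rightarrow> real) \<Rightarrow> 'k set \<Rightarrow> 'k set \<Rightarrow> bool"
  where "completion_of v F E \<longleftrightarrow>
    subfield F fld \<and> subfield E fld \<and> F \<subseteq> E \<and>
    Metric_space.mcomplete E (vdist v) \<and>
    E \<subseteq> Metric_space.mtopology E (vdist v) closure_of F"

text \<open>The localization of a subring \<open>A\<close> of \<open>K\<close> at its ideal \<open>pA\<close>, when that ideal is prime.\<close>

definition local_p :: "nat \<Rightarrow> 'k::field_char_0 set \<Rightarrow> 'k set"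
  where "local_p p A = {f / g | f g. f \<in> A \<and> g \<in> A \<and> (\<forall>h\<in>A. g \<noteq> of_nat p * h)}"

locale gauss_tower =
  fixes p :: nat and v :: "'k::field_char_0 \<Rightarrow> real"
    and Qp K0 Kbar :: "'k set" and T :: 'k
  assumes prime: "Factorial_Ring.prime p"
    and abs: "nonarch_abs v"
    and padic: "\<And>a :: int. a \<noteq> 0 \<Longrightarrow> v (of_int a) = (1 / real p) ^ multiplicity (int p) a"
    and Qp: "completion_of v \<rat> Qp"
    and T_transcendental: "(ring.transcendental fld over Qp) T"
    \<comment> \<open>the valuation ring of \<open>v\<close> on \<open>\<rat>\<^sub>p(T)\<close> is the localization of \<open>\<int>\<^sub>p[T]\<close> at \<open>(p)\<close>\<close>
    and gauss: "{x \<in> generate_field fld (insert T Qp). v x \<le> 1} =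
      local_p p (generate_ring fld (insert T {c \<in> Qp. v c \<le> 1}))"
    and K0: "completion_of v (generate_field fld (insert T Qp)) K0"
    and Kbar: "algebraic_closure (fld\<lparr>carrier := Kbar\<rparr>) K0"
    and K: "completion_of v Kbar UNIV"

definition root_system :: "nat \<Rightarrow> ('k::field_char_0 \<Rightarrow> real) \<Rightarrow> 'k set \<Rightarrow> 'k \<Rightarrow> (nat \<Rightarrow> 'k) \<Rightarrow> bool"
  where "root_system p v Kbar x r \<longleftrightarrow>
    r 0 = x \<and> (\<forall>n. r n \<in> Kbar \<and> v (r n) \<le> 1) \<and> (\<forall>n. r (Suc n) ^ p = r n)"

definition OK :: "('k::field_char_0 \<Rightarrow> real) \<Rightarrow> 'k ring"
  where "OK v = fld\<lparr>carrier := {x. v x \<le> 1}\<rparr>"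

section \<open>The tilt\<close>

definition frob_limit :: "nat \<Rightarrow> ('a, 'b) ring_scheme \<Rightarrow> (nat \<Rightarrow> 'a) ring"
  where "frob_limit p R =
    \<lparr>carrier = {x. (\<forall>n. x n \<in> carrier R) \<and> (\<forall>n. x (Suc n) [^]\<^bsub>R\<^esub> p = x n)},
     monoid.mult = (\<lambda>x y n. x n \<otimes>\<^bsub>R\<^esub> y n), one = (\<lambda>n. \<one>\<^bsub>R\<^esub>),
     ring.zero = (\<lambda>n. \<zero>\<^bsub>R\<^esub>), add = (\<lambda>x y n. x n \<oplus>\<^bsub>R\<^esub> y n)\<rparr>"

definition OK_flat :: "nat \<Rightarrow> ('k::field_char_0 \<Rightarrow> real) \<Rightarrow> (nat \<Rightarrow> 'k set) ring"
  where "OK_flat p v = frob_limit p (OK v Quot (PIdl\<^bsub>OK v\<^esub> (of_nat p)))"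

text \<open>The element \<open>X\<^sup>\<flat>\<close> defined by the system of roots \<open>r\<close> of \<open>X\<close>.\<close>

definition flat :: "nat \<Rightarrow> ('k::field_char_0 \<Rightarrow> real) \<Rightarrow> (nat \<Rightarrow> 'k) \<Rightarrow> nat \<Rightarrow> 'k set"
  where "flat p v r = (\<lambda>n. (PIdl\<^bsub>OK v\<^esub> (of_nat p)) +>\<^bsub>OK v\<^esub> r n)"

text \<open>A residue class is a coset, so its lifts are its elements.\<close>

definition sharp :: "nat \<Rightarrow> ('k::field_char_0 \<Rightarrow> real) \<Rightarrow> nat \<Rightarrow> (nat \<Rightarrow> 'k set) \<Rightarrow> 'k"
  where "sharp p v n x =
    (THE l. \<forall>y. (\<forall>k. y k \<in> x k) \<longrightarrow> vtendsto v (\<lambda>j. y (n + j) ^ (p ^ j)) l)"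

section \<open>Witt vectors\<close>

text \<open>
  \<open>('v \<Rightarrow>\<^sub>0 nat) \<Rightarrow>\<^sub>0 int\<close> is the polynomial ring over the integers in variables \<open>'v\<close>; for the
  structure polynomials, \<open>Inl i\<close> and \<open>Inr i\<close> are the variables \<open>X\<^sub>i\<close> and \<open>Y\<^sub>i\<close>.
\<close>

type_synonym 'v int_mpoly = "('v \<Rightarrow>\<^sub>0 nat) \<Rightarrow>\<^sub>0 int"

definition mvar :: "'v \<Rightarrow> 'v int_mpoly"
  where "mvar i = Poly_Mapping.single (Poly_Mapping.single i 1) 1"

definition mpoly_eval :: "('a, 'b) ring_scheme \<Rightarrow> ('v \<Rightarrow> 'a) \<Rightarrow> 'v int_mpoly \<Rightarrow> 'a"
  where "mpoly_eval R f P =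
    (\<Oplus>\<^bsub>R\<^esub>m\<in>Poly_Mapping.keys P. [Poly_Mapping.lookup P m] \<cdot>\<^bsub>R\<^esub>
      (\<Otimes>\<^bsub>R\<^esub>i\<in>Poly_Mapping.keys m. f i [^]\<^bsub>R\<^esub> Poly_Mapping.lookup m i))"

definition ghost :: "nat \<Rightarrow> nat \<Rightarrow> (nat \<Rightarrow> 'a::comm_ring_1) \<Rightarrow> 'a"
  where "ghost p n x = (\<Sum>i\<le>n. of_nat p ^ i * x i ^ (p ^ (n - i)))"

definition witt_sum :: "nat \<Rightarrow> nat \<Rightarrow> (nat + nat) int_mpoly"
  where "witt_sum p = (THE s. \<forall>n. ghost p n s =
    ghost p n (\<lambda>i. mvar (Inl i)) + ghost p n (\<lambda>i. mvar (Inr i)))"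

definition witt_prod :: "nat \<Rightarrow> nat \<Rightarrow> (nat + nat) int_mpoly"
  where "witt_prod p = (THE s. \<forall>n. ghost p n s =
    ghost p n (\<lambda>i. mvar (Inl i)) * ghost p n (\<lambda>i. mvar (Inr i)))"

definition teich :: "('a, 'b) ring_scheme \<Rightarrow> 'a \<Rightarrow> nat \<Rightarrow> 'a"
  where "teich R a = (\<lambda>n. if n = 0 then a else \<zero>\<^bsub>R\<^esub>)"

definition witt :: "nat \<Rightarrow> ('a, 'b) ring_scheme \<Rightarrow> (nat \<Rightarrow> 'a) ring"
  where "witt p R =
    \<lparr>carrier = {x. \<forall>n. x n \<in> carrier R},
     monoid.mult = (\<lambda>x y n. mpoly_eval R (case_sum x y) (witt_prod p n)),
     one = teich R \<one>\<^bsub>R\<^esub>,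
     ring.zero = (\<lambda>n. \<zero>\<^bsub>R\<^esub>),
     add = (\<lambda>x y n. mpoly_eval R (case_sum x y) (witt_sum p n))\<rparr>"

definition Ainf :: "nat \<Rightarrow> ('k::field_char_0 \<Rightarrow> real) \<Rightarrow> (nat \<Rightarrow> nat \<Rightarrow> 'k set) ring"
  where "Ainf p v = witt p (OK_flat p v)"

definition theta :: "nat \<Rightarrow> ('k::field_char_0 \<Rightarrow> real) \<Rightarrow> (nat \<Rightarrow> nat \<Rightarrow> 'k set) \<Rightarrow> 'k"
  where "theta p v x = vlim v (\<lambda>N. \<Sum>n<N. of_nat p ^ n * sharp p v n (x n))"

end

theory Submission
  imports Defs
begin

text \<open>
  Project \<open>A\<close> to the \<open>n\<close>-th component \<open>\<O>\<^sub>K/p\<close> of the tilt, lift its Witt components to \<open>a\<^sub>0, a\<^sub>1, \<dots>\<close> in \<open>\<O>\<^sub>K\<close>, and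
  put \<open>Q = p\<^bsup>1/p^n\<^esup>\<close>, \<open>t = T\<^bsup>1/p^n\<^esup>\<close>, \<open>s = S\<^bsup>1/p^n\<^esup>\<close>. The \<open>m\<close>-th ghost component is defined modulo \<open>p\<^bsup>m+1\<^esup>\<close> and all of
  them together determine a Witt vector over \<open>\<O>\<^sub>K/p\<close>; so \<open>\<theta>(A) \<equiv> \<Sum>\<^bsub>i<n\<^esub> p\<^sup>i a\<^sub>i\<^bsup>p^(n-i)\<^esup>\<close> modulo \<open>p\<^sup>n\<close>, and the
  equation for \<open>A\<close> says \<open>w\<^sub>m(a) (Q\<^bsup>p^m\<^esup> - p) \<equiv> t\<^bsup>p^m\<^esup> + s\<^bsup>p^m\<^esup> - 1\<close> modulo \<open>p\<^bsup>m+1\<^esup>\<close>.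

  Since \<open>p = V F\<close> in characteristic \<open>p\<close>, the equation reads \<open>[p\<^sup>\<flat>] A = u + V F A\<close> with
  \<open>u = [T\<^sup>\<flat>] + [S\<^sup>\<flat>] - 1\<close>, which can be solved recursively by Laurent polynomials \<open>b\<^sub>j\<close> in \<open>Q, t, s\<close> taken as
  indeterminates. Division by powers of \<open>Q\<close> loses precision, but the \<open>p\<close>-th powers in \<open>F A\<close> restore it, so
  that \<open>b\<^sub>j \<equiv> Q\<^bsup>p^j\<^esup> a\<^sub>j\<close> modulo \<open>p\<close> and the sum above is \<open>\<equiv> e/p\<close> with \<open>e = \<Sum>\<^bsub>i<n\<^esub> p\<^sup>i b\<^sub>i\<^bsup>p^(n-i)\<^esup>\<close>. Dwork's
  congruences give, with formal integral coefficients, \<open>e \<equiv> (t\<^bsup>p^n\<^esup> + s\<^bsup>p^n\<^esup> - 1) G\<close> modulo \<open>p\<^sup>n\<close>. The right-hand side is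
  \<open>0\<close> in \<open>K\<close>, and the poles of \<open>e\<close> are so mild that \<open>p\<^sup>n\<close> times a Laurent polynomial with these poles lies in
  \<open>p \<int>[Q\<^sup>p, t, s]\<close>.
\<close>

section \<open>Integer polynomials and Dwork's lemma\<close>

definition mono_ev :: "('v \<Rightarrow> 'a::comm_ring_1) \<Rightarrow> ('v \<Rightarrow>\<^sub>0 nat) \<Rightarrow> 'a"
  where "mono_ev f m = (\<Prod>i\<in>Poly_Mapping.keys m. f i ^ Poly_Mapping.lookup m i)"

definition mpoly_ev :: "('v \<Rightarrow> 'a::comm_ring_1) \<Rightarrow> 'v int_mpoly \<Rightarrow> 'a"
  where "mpoly_ev f P = (\<Sum>m\<in>Poly_Mapping.keys P. of_int (Poly_Mapping.lookup P m) * mono_ev f m)"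

lemma mono_ev_superset:
  assumes "finite A" "Poly_Mapping.keys m \<subseteq> A"
  shows "mono_ev f m = (\<Prod>i\<in>A. f i ^ Poly_Mapping.lookup m i)"
  unfolding mono_ev_def
  by (rule prod.mono_neutral_left) (use assms in \<open>auto simp: in_keys_iff\<close>)

lemma mono_ev_add: "mono_ev f (m + n) = mono_ev f m * mono_ev f n"
proof -
  let ?A = "Poly_Mapping.keys m \<union> Poly_Mapping.keys n"
  have "mono_ev f (m + n) = (\<Prod>i\<in>?A. f i ^ Poly_Mapping.lookup (m + n) i)"
    by (rule mono_ev_superset) (auto simp: Poly_Mapping.keys_add)
  then show ?thesis
    by (simp add: mono_ev_superset[of ?A m f] mono_ev_superset[of ?A n f] lookup_add power_add prod.distrib)
qed

lemma mono_ev_zero [simp]: "mono_ev f 0 = 1"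
  by (simp add: mono_ev_def)

lemma mono_ev_single [simp]: "mono_ev f (Poly_Mapping.single i k) = f i ^ k"
  by (simp add: mono_ev_def)

lemma mpoly_ev_superset:
  assumes "finite A" "Poly_Mapping.keys P \<subseteq> A"
  shows "mpoly_ev f P = (\<Sum>m\<in>A. of_int (Poly_Mapping.lookup P m) * mono_ev f m)"
  unfolding mpoly_ev_def
  by (rule sum.mono_neutral_left) (use assms in \<open>auto simp: in_keys_iff\<close>)

lemma mpoly_ev_add [simp]: "mpoly_ev f (P + Q) = mpoly_ev f P + mpoly_ev f Q"
proof -
  let ?A = "Poly_Mapping.keys P \<union> Poly_Mapping.keys Q"
  have "mpoly_ev f (P + Q) = (\<Sum>m\<in>?A. of_int (Poly_Mapping.lookup (P + Q) m) * mono_ev f m)"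
    by (rule mpoly_ev_superset) (auto simp: Poly_Mapping.keys_add)
  then show ?thesis
    by (simp add: mpoly_ev_superset[of ?A P f] mpoly_ev_superset[of ?A Q f] lookup_add
        distrib_right sum.distrib)
qed

lemma mpoly_ev_zero [simp]: "mpoly_ev f 0 = 0"
  by (simp add: mpoly_ev_def)

lemma mpoly_ev_single [simp]: "mpoly_ev f (Poly_Mapping.single m c) = of_int c * mono_ev f m"
  by (simp add: mpoly_ev_def)

lemma mpoly_ev_sum [simp]: "mpoly_ev f (sum P A) = (\<Sum>i\<in>A. mpoly_ev f (P i))"
  by (induction A rule: infinite_finite_induct) auto

lemma poly_mapping_sum_single:
  "P = (\<Sum>m\<in>Poly_Mapping.keys P. Poly_Mapping.single m (Poly_Mapping.lookup P m))"
proof (rule poly_mapping_eqI)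
  fix k
  show "Poly_Mapping.lookup P k =
    Poly_Mapping.lookup (\<Sum>m\<in>Poly_Mapping.keys P. Poly_Mapping.single m (Poly_Mapping.lookup P m)) k"
    by (simp add: lookup_sum lookup_single when_def in_keys_iff)
qed

lemma mpoly_ev_mult [simp]: "mpoly_ev f (P * Q) = mpoly_ev f P * mpoly_ev f Q"
proof -
  let ?s = "\<lambda>P m. Poly_Mapping.single m (Poly_Mapping.lookup P m)"
  have "P * Q = (\<Sum>m\<in>Poly_Mapping.keys P. ?s P m) * (\<Sum>n\<in>Poly_Mapping.keys Q. ?s Q n)"
    by (simp flip: poly_mapping_sum_single)
  then have "mpoly_ev f (P * Q) =
      (\<Sum>m\<in>Poly_Mapping.keys P. \<Sum>n\<in>Poly_Mapping.keys Q. mpoly_ev f (?s P m) * mpoly_ev f (?s Q n))"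
    by (simp add: sum_product mult_single mono_ev_add mult_ac)
  then show ?thesis
    unfolding sum_product[symmetric] by (simp flip: mpoly_ev_def)
qed

lemma mpoly_ev_one [simp]: "mpoly_ev f 1 = 1"
  by (simp flip: single_one)

lemma mpoly_ev_power [simp]: "mpoly_ev f (P ^ n) = mpoly_ev f P ^ n"
  by (induction n) auto

lemma mpoly_ev_uminus [simp]: "mpoly_ev f (- P) = - mpoly_ev f P"
  using mpoly_ev_add[of f P "- P"] by (simp add: eq_neg_iff_add_eq_0 add.commute)

lemma mpoly_ev_diff [simp]: "mpoly_ev f (P - Q) = mpoly_ev f P - mpoly_ev f Q"
  using mpoly_ev_add[of f P "- Q"] by simp

lemma mpoly_ev_of_nat [simp]: "mpoly_ev f (of_nat n) = of_nat n"
  by (induction n) auto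

lemma mpoly_ev_of_int [simp]: "mpoly_ev f (of_int n) = of_int n"
  by (cases n rule: int_diff_cases) simp

lemma mpoly_ev_mvar [simp]: "mpoly_ev f (mvar i) = f i"
  by (simp add: mvar_def)

lemma mpoly_ev_ghost [simp]: "mpoly_ev f (ghost p n s) = ghost p n (\<lambda>i. mpoly_ev f (s i))"
  by (simp add: ghost_def)

lemma int_mpoly_induct [case_names of_int mvar add mult]:
  assumes "\<And>c. R (of_int c)" "\<And>i. R (mvar i)"
    and "\<And>P Q. R P \<Longrightarrow> R Q \<Longrightarrow> R (P + Q)" "\<And>P Q. R P \<Longrightarrow> R Q \<Longrightarrow> R (P * Q)"
  shows "R (P :: 'v int_mpoly)"
proof -
  have pow: "R (Q ^ n)" if "R Q" for Q n
    by (induction n) (use that assms(1)[of 1] assms(4) in auto)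
  have mono: "R (Poly_Mapping.single m 1)" for m
  proof (induction "card (Poly_Mapping.keys m)" arbitrary: m)
    case 0
    then show ?case using assms(1)[of 1] by simp
  next
    case (Suc n)
    then obtain i where i: "i \<in> Poly_Mapping.keys m" by fastforce
    define m' where "m' = m - Poly_Mapping.single i (Poly_Mapping.lookup m i)"
    have m: "m = Poly_Mapping.single i (Poly_Mapping.lookup m i) + m'"
      by (rule poly_mapping_eqI) (auto simp: m'_def lookup_add lookup_minus lookup_single when_def)
    have "Poly_Mapping.keys m' = Poly_Mapping.keys m - {i}"
      by (auto simp: m'_def in_keys_iff lookup_minus lookup_single when_def split: if_splits)
    then have "R (Poly_Mapping.single m' 1)"
      using Suc i by simp
    moreover have "R (Poly_Mapping.single (Poly_Mapping.single i k) 1)" for k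
    proof -
      have "Poly_Mapping.single (Poly_Mapping.single i k) 1 = (mvar i ^ k :: 'v int_mpoly)"
      proof (induction k)
        case (Suc k)
        have "Poly_Mapping.single i (Suc k) = Poly_Mapping.single i 1 + Poly_Mapping.single i k"
          by (simp flip: single_add)
        then have "Poly_Mapping.single (Poly_Mapping.single i (Suc k)) 1 =
            (mvar i * Poly_Mapping.single (Poly_Mapping.single i k) 1 :: 'v int_mpoly)"
          by (simp only: mvar_def mult_single mult_1)
        then show ?case by (simp only: Suc power_Suc)
      qed simp
      then show ?thesis using pow assms(2) by simp
    qed
    ultimately have "R (Poly_Mapping.single (Poly_Mapping.single i (Poly_Mapping.lookup m i)) 1
        * Poly_Mapping.single m' 1)"
      using assms(4) by blast
    then show ?case by (simp add: mult_single flip: m)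
  qed
  have single: "R (Poly_Mapping.single m c)" for m c
    using assms(4)[OF assms(1)[of c] mono[of m]] by (simp add: mult_single flip: single_of_int)
  have "R (\<Sum>m\<in>A. Poly_Mapping.single m (c m))" if "finite A" for A and c :: "('v \<Rightarrow>\<^sub>0 nat) \<Rightarrow> int"
    using that by induction (use assms(1)[of 0] assms(3) single in auto)
  then show ?thesis
    using poly_mapping_sum_single[of P] by (metis finite_keys)
qed

lemma lookup_of_nat_mult:
  fixes P :: "'v int_mpoly"
  shows "Poly_Mapping.lookup (of_nat k * P) m = int k * Poly_Mapping.lookup P m"
proof -
  have "of_nat k * P = (\<Sum>i<k. P)" by simp
  then show ?thesis by (simp only: lookup_sum) simp
qed

lemma int_mpoly_torsion_free:
  fixes P Q :: "'v int_mpoly"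
  assumes "of_nat k * P = of_nat k * Q" "k \<noteq> 0"
  shows "P = Q"
  by (rule poly_mapping_eqI) (metis assms lookup_of_nat_mult mult_cancel_left of_nat_eq_0_iff)

lemma keys_of_nat_mult:
  fixes P :: "'v int_mpoly"
  assumes "k \<noteq> 0"
  shows "Poly_Mapping.keys (of_nat k * P) = Poly_Mapping.keys P"
  using assms by (auto simp: in_keys_iff lookup_of_nat_mult)

lemma prime_power_add:
  fixes x y :: "'a::comm_ring_1"
  assumes "Factorial_Ring.prime p"
  shows "(x + y) ^ p = x ^ p + y ^ p +
    of_nat p * (x * (\<Sum>i\<in>{1..<p}. of_nat ((p choose i) div p) * x ^ (i - 1) * y ^ (p - i)))"
proof -
  have p: "p > 1" using assms prime_gt_1_nat by blast
  have "(x + y) ^ p = (\<Sum>i\<le>p. of_nat (p choose i) * x ^ i * y ^ (p - i))"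
    by (rule binomial_ring)
  also have "{..p} = insert 0 (insert p {1..<p})" using p by auto
  also have "(\<Sum>i\<in>\<dots>. of_nat (p choose i) * x ^ i * y ^ (p - i)) =
      y ^ p + (x ^ p + (\<Sum>i\<in>{1..<p}. of_nat (p choose i) * x ^ i * y ^ (p - i)))"
    using p by simp
  also have "(\<Sum>i\<in>{1..<p}. of_nat (p choose i) * x ^ i * y ^ (p - i)) =
      (\<Sum>i\<in>{1..<p}. of_nat p * (x * (of_nat ((p choose i) div p) * x ^ (i - 1) * y ^ (p - i))))"
  proof (rule sum.cong[OF refl])
    fix i assume i: "i \<in> {1..<p}"
    then have "p dvd (p choose i)"
      using assms by (intro dvd_choose_prime) auto
    then have c: "(of_nat (p choose i) :: 'a) = of_nat p * of_nat ((p choose i) div p)"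
      by (simp flip: of_nat_mult)
    have "x ^ i = x * x ^ (i - 1)"
      using i by (cases i) auto
    then show "of_nat (p choose i) * x ^ i * y ^ (p - i) =
        of_nat p * (x * (of_nat ((p choose i) div p) * x ^ (i - 1) * y ^ (p - i)))"
      by (simp add: c mult_ac)
  qed
  finally show ?thesis
    by (simp add: sum_distrib_left algebra_simps)
qed

lemma cong_power_prime:
  fixes x y :: "'a::comm_ring_1"
  assumes p: "Factorial_Ring.prime p" and "of_nat p ^ Suc k dvd x - y"
  shows "of_nat p ^ Suc (Suc k) dvd x ^ p - y ^ p"
proof -
  define d where "d = x - y"
  obtain r where r: "(d + y) ^ p = d ^ p + y ^ p + of_nat p * (d * r)"
    using prime_power_add[OF p] by blast
  have "d ^ 2 dvd d ^ p"
    using prime_ge_2_nat[OF p] le_imp_power_dvd by blast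
  moreover have "(of_nat p :: 'a) ^ Suc (Suc k) dvd (of_nat p ^ Suc k) ^ 2"
    by (simp only: flip: power_mult) (rule le_imp_power_dvd, simp)
  moreover have "(of_nat p ^ Suc k) ^ 2 dvd d ^ 2"
    using assms unfolding d_def by (rule_tac dvd_power_same)
  ultimately have "of_nat p ^ Suc (Suc k) dvd d ^ p"
    by (meson dvd_trans)
  moreover have "of_nat p ^ Suc (Suc k) dvd of_nat p * (d * r)"
    using assms unfolding d_def by (simp add: mult_dvd_mono)
  ultimately have "of_nat p ^ Suc (Suc k) dvd d ^ p + of_nat p * (d * r)"
    by (rule dvd_add)
  moreover have "x ^ p - y ^ p = d ^ p + of_nat p * (d * r)"
    using r by (simp add: d_def)
  ultimately show ?thesis by simp
qed

lemma cong_power_prime_power: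
  fixes x y :: "'a::comm_ring_1"
  assumes p: "Factorial_Ring.prime p" and "of_nat p dvd x - y"
  shows "of_nat p ^ Suc k dvd x ^ (p ^ k) - y ^ (p ^ k)"
proof (induction k)
  case (Suc k)
  then show ?case
    using cong_power_prime[OF p Suc] by (simp add: mult.commute flip: power_mult)
qed (use assms in simp)

definition frob_lift :: "nat \<Rightarrow> 'v int_mpoly \<Rightarrow> 'v int_mpoly"
  where "frob_lift p = mpoly_ev (\<lambda>i. mvar i ^ p)"

lemma fermat_int:
  assumes "Factorial_Ring.prime (p::nat)"
  shows "int p dvd c ^ p - c"
proof -
  have nat: "int p dvd int n ^ p - int n" for n
  proof (induction n)
    case 0
    then show ?case using prime_gt_0_nat[OF assms] by (simp add: power_0_left)
  next
    case (Suc n)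
    obtain r where "(int n + 1) ^ p = int n ^ p + 1 ^ p + of_nat p * (int n * r)"
      using prime_power_add[OF assms] by blast
    then have "int (Suc n) ^ p - int (Suc n) = (int n ^ p - int n) + int p * (int n * r)"
      by (simp add: algebra_simps)
    then show ?case using Suc by (metis dvd_add dvd_triv_left)
  qed
  define n where "n = nat (c mod int p)"
  have "int p dvd c - int n"
    using prime_gt_0_nat[OF assms] by (simp add: n_def)
  then have "int p dvd c ^ p - int n ^ p"
    using cong_power_prime[OF assms, of 0 c "int n"] by (auto elim: dvd_mult_left)
  then have "int p dvd (c ^ p - int n ^ p) + (int n ^ p - int n) - (c - int n)"
    using dvd_diff[OF dvd_add[OF _ nat] \<open>int p dvd c - int n\<close>] by blast
  then show ?thesis by simp
qed

lemma frob_lift_cong: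
  assumes p: "Factorial_Ring.prime p"
  shows "of_nat p dvd P ^ p - frob_lift p P"
proof (induction P rule: int_mpoly_induct)
  case (of_int c)
  have "(of_int (int p) :: 'a int_mpoly) dvd of_int (c ^ p - c)"
    using fermat_int[OF p, of c] by (metis dvd_def of_int_mult)
  then show ?case by (simp add: frob_lift_def)
next
  case (mvar i)
  then show ?case by (simp add: frob_lift_def)
next
  case (add P Q)
  obtain r where "(P + Q) ^ p = P ^ p + Q ^ p + of_nat p * (P * r)"
    using prime_power_add[OF p] by blast
  then have "(P + Q) ^ p - frob_lift p (P + Q) =
      (P ^ p - frob_lift p P) + (Q ^ p - frob_lift p Q) + of_nat p * (P * r)"
    by (simp add: frob_lift_def)
  then show ?case using add by simp
next
  case (mult P Q)
  have "(P * Q) ^ p - frob_lift p (P * Q) =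
      (P ^ p - frob_lift p P) * Q ^ p + frob_lift p P * (Q ^ p - frob_lift p Q)"
    by (simp add: frob_lift_def algebra_simps)
  then show ?case using mult by simp
qed

definition ghost_init :: "nat \<Rightarrow> nat \<Rightarrow> (nat \<Rightarrow> 'a::comm_ring_1) \<Rightarrow> 'a"
  where "ghost_init p n x = (\<Sum>i<n. of_nat p ^ i * x i ^ (p ^ (n - i)))"

lemma ghost_eq_init: "ghost p n x = ghost_init p n x + of_nat p ^ n * x n"
  unfolding ghost_def ghost_init_def lessThan_Suc_atMost[symmetric] by simp

lemma ghost_init_Suc: "ghost_init p (Suc n) x = ghost p n (\<lambda>i. x i ^ p)"
  unfolding ghost_def ghost_init_def lessThan_Suc_atMost
  by (rule sum.cong) (auto simp: Suc_diff_le simp flip: power_mult)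

lemma ghost_init_cong: "(\<And>i. i < n \<Longrightarrow> x i = y i) \<Longrightarrow> ghost_init p n x = ghost_init p n y"
  unfolding ghost_init_def by (rule sum.cong) auto

lemma ghost_dvd:
  fixes x y :: "nat \<Rightarrow> 'a::comm_ring_1"
  assumes p: "Factorial_Ring.prime p" and "\<And>i. i \<le> n \<Longrightarrow> of_nat p dvd x i - y i"
  shows "of_nat p ^ Suc n dvd ghost p n x - ghost p n y"
proof -
  have "of_nat p ^ Suc n dvd of_nat p ^ i * x i ^ (p ^ (n - i)) - of_nat p ^ i * y i ^ (p ^ (n - i))"
    if i: "i \<in> {..n}" for i
  proof -
    have "of_nat p ^ i * of_nat p ^ Suc (n - i)
        dvd of_nat p ^ i * (x i ^ (p ^ (n - i)) - y i ^ (p ^ (n - i)))"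
      by (rule mult_dvd_mono[OF dvd_refl cong_power_prime_power[OF p]]) (use assms i in auto)
    then show ?thesis
      using i by (simp only: right_diff_distrib flip: power_add) simp
  qed
  then show ?thesis
    unfolding ghost_def sum_subtractf[symmetric] by (rule dvd_sum)
qed

lemma ghost_init_frob_lift:
  assumes "Factorial_Ring.prime p"
  shows "of_nat p ^ Suc n dvd ghost_init p (Suc n) s - frob_lift p (ghost p n s)"
proof -
  have "frob_lift p (ghost p n s) = ghost p n (\<lambda>i. frob_lift p (s i))"
    by (simp add: frob_lift_def)
  then show ?thesis
    unfolding ghost_init_Suc by (simp only:) (intro ghost_dvd assms frob_lift_cong)
qed

text \<open>Dwork's lemma. The target \<open>F n\<close> may depend on the components of index below \<open>n\<close>.\<close>

lemma dwork:
  fixes F :: "nat \<Rightarrow> (nat \<Rightarrow> 'v int_mpoly) \<Rightarrow> 'v int_mpoly"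
  assumes p: "Factorial_Ring.prime p"
    and local: "\<And>n s s'. (\<And>i. i < n \<Longrightarrow> s i = s' i) \<Longrightarrow> F n s = F n s'"
    and step: "\<And>n s. ghost p n s = F n s \<Longrightarrow> of_nat p ^ Suc n dvd F (Suc n) s - frob_lift p (F n s)"
  shows "\<exists>s. \<forall>n. ghost p n s = F n s"
proof -
  have "\<exists>s. \<forall>n. F n s = ghost_init p n s + of_nat p ^ n * s n"
  proof (rule dependent_wellorder_choice)
    fix r :: "'v int_mpoly" and s s' :: "nat \<Rightarrow> 'v int_mpoly" and n
    assume "\<And>i. i < n \<Longrightarrow> s i = s' i"
    then show "(F n s = ghost_init p n s + of_nat p ^ n * r) = (F n s' = ghost_init p n s' + of_nat p ^ n * r)"
      using local[of n s s'] ghost_init_cong[of n s s' p] by simp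
  next
    fix n :: nat and s
    assume IH: "\<And>m. m < n \<Longrightarrow> F m s = ghost_init p m s + of_nat p ^ m * s m"
    have "of_nat p ^ n dvd F n s - ghost_init p n s"
    proof (cases n)
      case (Suc m)
      then have g: "ghost p m s = F m s"
        using IH[of m] by (simp add: ghost_eq_init)
      have "of_nat p ^ Suc m dvd (F (Suc m) s - frob_lift p (F m s))
          - (ghost_init p (Suc m) s - frob_lift p (ghost p m s))"
        by (intro dvd_diff step[OF g] ghost_init_frob_lift[OF p])
      then show ?thesis using Suc by (simp add: g)
    qed simp
    then obtain r where "F n s - ghost_init p n s = of_nat p ^ n * r" by (elim dvdE)
    then show "\<exists>r. F n s = ghost_init p n s + of_nat p ^ n * r"
      by (metis add.commute diff_add_cancel)
  qed
  then show ?thesis by (metis ghost_eq_init)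
qed

lemma ghost_inject:
  fixes s s' :: "nat \<Rightarrow> 'v int_mpoly"
  assumes "p \<noteq> 0" "\<And>n. ghost p n s = ghost p n s'"
  shows "s = s'"
proof
  fix n
  show "s n = s' n"
  proof (induction n rule: less_induct)
    case (less n)
    have "ghost_init p n s = ghost_init p n s'"
      using less by (rule ghost_init_cong)
    then have "of_nat (p ^ n) * s n = of_nat (p ^ n) * s' n"
      using assms(2)[of n] by (simp add: ghost_eq_init)
    then show ?case
      by (rule int_mpoly_torsion_free) (use assms in simp)
  qed
qed

lemma ghost_mvar_frob_lift:
  assumes "Factorial_Ring.prime p"
  shows "of_nat p ^ Suc n dvd ghost p (Suc n) (\<lambda>i. mvar (f i)) - frob_lift p (ghost p n (\<lambda>i. mvar (f i)))"
proof -
  have "ghost p (Suc n) (\<lambda>i. mvar (f i)) - frob_lift p (ghost p n (\<lambda>i. mvar (f i)))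
      = of_nat p ^ Suc n * mvar (f (Suc n))"
    by (simp add: frob_lift_def ghost_eq_init[of p "Suc n"] ghost_init_Suc)
  then show ?thesis by simp
qed

lemma witt_sum_ghost:
  assumes p: "Factorial_Ring.prime p"
  shows "ghost p n (witt_sum p) = ghost p n (\<lambda>i. mvar (Inl i)) + ghost p n (\<lambda>i. mvar (Inr i))"
proof -
  let ?X = "\<lambda>n. ghost p n (\<lambda>i. mvar (Inl i))" and ?Y = "\<lambda>n. ghost p n (\<lambda>i. mvar (Inr i))"
  have "\<exists>s :: nat \<Rightarrow> (nat + nat) int_mpoly. \<forall>n. ghost p n s = ?X n + ?Y n"
  proof (rule dwork[OF p])
    fix n
    have "of_nat p ^ Suc n dvd (?X (Suc n) - frob_lift p (?X n)) + (?Y (Suc n) - frob_lift p (?Y n))"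
      by (intro dvd_add ghost_mvar_frob_lift[OF p])
    then show "of_nat p ^ Suc n dvd ?X (Suc n) + ?Y (Suc n) - frob_lift p (?X n + ?Y n)"
      by (simp add: frob_lift_def algebra_simps)
  qed auto
  then obtain s :: "nat \<Rightarrow> (nat + nat) int_mpoly" where s: "\<forall>n. ghost p n s = ?X n + ?Y n" ..
  have "\<forall>n. ghost p n (witt_sum p) = ?X n + ?Y n"
    unfolding witt_sum_def
    by (rule theI[of "\<lambda>s. \<forall>n. ghost p n s = ?X n + ?Y n", OF s])
      (use s prime_gt_0_nat[OF p] in \<open>auto intro!: ghost_inject[of p]\<close>)
  then show ?thesis by simp
qed

lemma witt_prod_ghost:
  assumes p: "Factorial_Ring.prime p"
  shows "ghost p n (witt_prod p) = ghost p n (\<lambda>i. mvar (Inl i)) * ghost p n (\<lambda>i. mvar (Inr i))"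
proof -
  let ?X = "\<lambda>n. ghost p n (\<lambda>i. mvar (Inl i))" and ?Y = "\<lambda>n. ghost p n (\<lambda>i. mvar (Inr i))"
  have "\<exists>s :: nat \<Rightarrow> (nat + nat) int_mpoly. \<forall>n. ghost p n s = ?X n * ?Y n"
  proof (rule dwork[OF p])
    fix n
    have "of_nat p ^ Suc n dvd (?X (Suc n) - frob_lift p (?X n)) * ?Y (Suc n)
        + frob_lift p (?X n) * (?Y (Suc n) - frob_lift p (?Y n))"
      by (intro dvd_add dvd_mult dvd_mult2 ghost_mvar_frob_lift[OF p])
    then show "of_nat p ^ Suc n dvd ?X (Suc n) * ?Y (Suc n) - frob_lift p (?X n * ?Y n)"
      by (simp add: frob_lift_def algebra_simps)
  qed auto
  then obtain s :: "nat \<Rightarrow> (nat + nat) int_mpoly" where s: "\<forall>n. ghost p n s = ?X n * ?Y n" ..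
  have "\<forall>n. ghost p n (witt_prod p) = ?X n * ?Y n"
    unfolding witt_prod_def
    by (rule theI[of "\<lambda>s. \<forall>n. ghost p n s = ?X n * ?Y n", OF s])
      (use s prime_gt_0_nat[OF p] in \<open>auto intro!: ghost_inject[of p]\<close>)
  then show ?thesis by simp
qed

lemma witt_neg_ghost_ex:
  assumes p: "Factorial_Ring.prime p"
  shows "\<exists>s :: nat \<Rightarrow> nat int_mpoly. \<forall>n. ghost p n s = - ghost p n mvar"
proof (rule dwork[OF p])
  fix n
  show "of_nat p ^ Suc n dvd - ghost p (Suc n) mvar - frob_lift p (- ghost p n (mvar :: nat \<Rightarrow> _))"
    using ghost_mvar_frob_lift[OF p, of n "\<lambda>i. i"]
    by (simp add: frob_lift_def) (metis add.inverse_inverse dvd_minus_iff minus_diff_eq uminus_add_conv_diff)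
qed auto

section \<open>Congruences modulo powers of p\<close>

locale p_adic_abs =
  fixes p :: nat and v :: "'k::field_char_0 \<Rightarrow> real"
  assumes prime: "Factorial_Ring.prime p"
    and abs: "nonarch_abs v"
    and v_p: "v (of_nat p) = 1 / real p"
begin

lemma p_gt_1: "p > 1" and p_gt_0: "p > 0"
  using prime prime_gt_1_nat prime_gt_0_nat by blast+

lemma v_nonneg [simp]: "0 \<le> v x"
  and v_eq_0 [simp]: "v x = 0 \<longleftrightarrow> x = 0"
  and v_mult: "v (x * y) = v x * v y"
  and v_add: "v (x + y) \<le> max (v x) (v y)"
  using abs unfolding nonarch_abs_def by auto

lemma v_zero [simp]: "v 0 = 0"
  by simp

lemma v_one [simp]: "v 1 = 1"
  using v_mult[of 1 1] v_eq_0[of 1] by (simp del: v_eq_0)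

lemma v_minus [simp]: "v (- x) = v x"
proof -
  have "v (- 1) * v (- 1) = 1"
    by (simp flip: v_mult)
  then have "v (- 1) = 1"
    using v_nonneg[of "- 1"] by (auto simp: square_eq_1_iff)
  then show ?thesis
    using v_mult[of "- 1" x] by simp
qed

lemma v_commute: "v (x - y) = v (y - x)"
  by (metis minus_diff_eq v_minus)

lemma v_power: "v (x ^ n) = v x ^ n"
  by (induction n) (auto simp: v_mult)

lemma v_divide: "v (x / y) = v x / v y"
proof (cases "y = 0")
  case False
  then have "v (x / y) * v y = v x"
    by (simp flip: v_mult)
  then show ?thesis using False by (simp add: field_simps)
qed simp

lemma v_add_le: "v x \<le> c \<Longrightarrow> v y \<le> c \<Longrightarrow> v (x + y) \<le> c"
  using v_add[of x y] by simp

lemma v_diff_le: "v x \<le> c \<Longrightarrow> v y \<le> c \<Longrightarrow> v (x - y) \<le> c"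
  using v_add_le[of x c "- y"] by simp

lemma v_sum_le: "(\<And>i. i \<in> A \<Longrightarrow> v (f i) \<le> c) \<Longrightarrow> 0 \<le> c \<Longrightarrow> v (sum f A) \<le> c"
  by (induction A rule: infinite_finite_induct) (auto intro: v_add_le)

lemma v_mult_le_one: "v x \<le> 1 \<Longrightarrow> v y \<le> 1 \<Longrightarrow> v (x * y) \<le> 1"
  by (simp add: v_mult mult_le_one)

lemma v_power_le_one: "v x \<le> 1 \<Longrightarrow> v (x ^ n) \<le> 1"
  by (simp add: v_power power_le_one)

lemma v_of_nat_le_one [simp]: "v (of_nat n) \<le> 1"
  by (induction n) (auto intro: v_add_le)

lemma v_of_int_le_one [simp]: "v (of_int n) \<le> 1"
  by (cases n rule: int_diff_cases) (auto intro: v_diff_le)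

lemma v_p_power: "v (of_nat p ^ n) = (1 / real p) ^ n"
  by (simp add: v_power v_p)

definition cong_mod :: "nat \<Rightarrow> 'k \<Rightarrow> 'k \<Rightarrow> bool"
  where "cong_mod n x y \<longleftrightarrow> v (x - y) \<le> (1 / real p) ^ n"

lemma cong_mod_refl [simp]: "cong_mod n x x"
  by (simp add: cong_mod_def)

lemma cong_mod_sym: "cong_mod n x y \<Longrightarrow> cong_mod n y x"
  by (simp add: cong_mod_def v_commute)

lemma cong_mod_trans [trans]: "cong_mod n x y \<Longrightarrow> cong_mod n y z \<Longrightarrow> cong_mod n x z"
  using v_add_le[of "x - y" "(1 / real p) ^ n" "y - z"] by (simp add: cong_mod_def)

lemma cong_mod_add: "cong_mod n x y \<Longrightarrow> cong_mod n x' y' \<Longrightarrow> cong_mod n (x + x') (y + y')"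
  using v_add_le[of "x - y" "(1 / real p) ^ n" "x' - y'"] by (simp add: cong_mod_def algebra_simps)

lemma cong_mod_minus: "cong_mod n x y \<Longrightarrow> cong_mod n (- x) (- y)"
  using v_commute[of x y] by (simp add: cong_mod_def add.commute)

lemma cong_mod_diff: "cong_mod n x y \<Longrightarrow> cong_mod n x' y' \<Longrightarrow> cong_mod n (x - x') (y - y')"
  using cong_mod_add[of n x y "- x'" "- y'"] cong_mod_minus by simp

lemma cong_mod_sum: "(\<And>i. i \<in> A \<Longrightarrow> cong_mod n (f i) (g i)) \<Longrightarrow> cong_mod n (sum f A) (sum g A)"
  by (induction A rule: infinite_finite_induct) (auto intro: cong_mod_add)

lemma cong_mod_mono:
  assumes "cong_mod n x y" "m \<le> n"
  shows "cong_mod m x y"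
proof -
  have "(1 / real p) ^ n \<le> (1 / real p) ^ m"
    using assms(2) p_gt_1 by (intro power_decreasing) auto
  then show ?thesis using assms(1) by (simp add: cong_mod_def)
qed

lemma cong_mod_mult_left: "cong_mod n x y \<Longrightarrow> v c \<le> 1 \<Longrightarrow> cong_mod n (c * x) (c * y)"
  by (simp add: cong_mod_def v_mult mult_left_le_one_le order_trans[of _ "v (x - y)"] flip: right_diff_distrib)

lemma cong_mod_mult:
  assumes "cong_mod n x y" "cong_mod n x' y'" "v x' \<le> 1" "v y \<le> 1"
  shows "cong_mod n (x * x') (y * y')"
  using cong_mod_mult_left[OF assms(1,3)] cong_mod_mult_left[OF assms(2,4)]
  by (metis cong_mod_trans mult.commute)

lemma cong_mod_p_mult: "cong_mod (n + k) (of_nat p ^ n * x) (of_nat p ^ n * y) \<longleftrightarrow> cong_mod k x y"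
  using p_gt_0
  by (simp add: cong_mod_def v_mult v_p_power power_add mult_le_cancel_left_pos flip: right_diff_distrib)

lemma v_le_one_cong: "cong_mod n x y \<Longrightarrow> v y \<le> 1 \<Longrightarrow> v x \<le> 1"
  using v_add_le[of "x - y" 1 y] cong_mod_mono[of n x y 0] by (simp add: cong_mod_def)

lemma v_mpoly_ev_le_one:
  assumes "\<And>i. v (f i) \<le> 1"
  shows "v (mpoly_ev f P) \<le> 1"
  by (induction P rule: int_mpoly_induct) (auto intro: v_add_le v_mult_le_one assms)

lemma v_ghost_le_one:
  assumes "\<And>i. i \<le> n \<Longrightarrow> v (x i) \<le> 1"
  shows "v (ghost p n x) \<le> 1"
  unfolding ghost_def
  by (intro v_sum_le v_mult_le_one v_power_le_one) (use assms in auto)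

lemma v_power_prime_diff:
  assumes "v y \<le> 1" "v (x - y) \<le> 1"
  shows "v (x ^ p - y ^ p) \<le> max (v (x - y) ^ p) (v (x - y) / real p)"
proof -
  define r where "r = (\<Sum>i\<in>{1..<p}. of_nat ((p choose i) div p) * (x - y) ^ (i - 1) * y ^ (p - i))"
  have "((x - y) + y) ^ p = (x - y) ^ p + y ^ p + of_nat p * ((x - y) * r)"
    unfolding r_def by (rule prime_power_add[OF prime])
  then have eq: "x ^ p - y ^ p = (x - y) ^ p + of_nat p * ((x - y) * r)"
    by simp
  have "v r \<le> 1"
    unfolding r_def by (intro v_sum_le v_mult_le_one v_power_le_one) (use assms in auto)
  then have "v (of_nat p * ((x - y) * r)) \<le> v (x - y) / real p"
    by (simp add: v_mult v_p mult_left_le divide_right_mono)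
  then show ?thesis
    using v_add[of "(x - y) ^ p" "of_nat p * ((x - y) * r)"] unfolding eq by (simp add: v_power)
qed

lemma cong_mod_power_prime:
  assumes "cong_mod (Suc n) x y" "v y \<le> 1"
  shows "cong_mod (Suc (Suc n)) (x ^ p) (y ^ p)"
proof -
  let ?d = "v (x - y)"
  have p1: "1 / real p \<le> 1" "1 / real p \<ge> 0"
    using p_gt_1 by auto
  have d: "?d \<le> (1 / real p) ^ Suc n" using assms by (simp add: cong_mod_def)
  also have "\<dots> \<le> 1 / real p"
    using power_decreasing[of 1 "Suc n" "1 / real p"] p1 by simp
  finally have d1: "?d \<le> 1 / real p" .
  then have d2: "?d \<le> 1" using p1 by linarith
  have "?d ^ p \<le> ?d ^ 2"
    using d2 prime_ge_2_nat[OF prime] by (intro power_decreasing) auto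
  also have "\<dots> \<le> ?d / real p"
    using mult_left_mono[OF d1, of ?d] by (simp add: power2_eq_square)
  finally have "v (x ^ p - y ^ p) \<le> ?d / real p"
    using v_power_prime_diff[OF assms(2) d2] by simp
  also have "\<dots> \<le> (1 / real p) ^ Suc n / real p"
    using d by (intro divide_right_mono) auto
  finally show ?thesis by (simp add: cong_mod_def)
qed

lemma cong_mod_power_prime_power:
  assumes "cong_mod (Suc 0) x y" "v y \<le> 1"
  shows "cong_mod (Suc n) (x ^ (p ^ n)) (y ^ (p ^ n))"
proof (induction n)
  case (Suc n)
  from cong_mod_power_prime[OF Suc v_power_le_one[OF assms(2)]] show ?case
    by (simp add: mult.commute flip: power_mult)
qed (use assms in simp)

lemma ghost_init_cong_mod:
  assumes "\<And>i. i < n \<Longrightarrow> cong_mod 1 (x i) (y i)" "\<And>i. i < n \<Longrightarrow> v (y i) \<le> 1"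
  shows "cong_mod (Suc n) (ghost_init p n x) (ghost_init p n y)"
  unfolding ghost_init_def
proof (rule cong_mod_sum)
  fix i assume "i \<in> {..<n}"
  then have "Suc n = i + Suc (n - i)"
    "cong_mod (Suc (n - i)) (x i ^ (p ^ (n - i))) (y i ^ (p ^ (n - i)))"
    using assms by (auto intro: cong_mod_power_prime_power)
  then show "cong_mod (Suc n) (of_nat p ^ i * x i ^ (p ^ (n - i))) (of_nat p ^ i * y i ^ (p ^ (n - i)))"
    by (metis cong_mod_p_mult)
qed

lemma ghost_cong_mod:
  assumes "\<And>i. i \<le> n \<Longrightarrow> cong_mod 1 (x i) (y i)" "\<And>i. i \<le> n \<Longrightarrow> v (y i) \<le> 1"
  shows "cong_mod (Suc n) (ghost p n x) (ghost p n y)"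
  unfolding ghost_eq_init using assms
  by (intro cong_mod_add ghost_init_cong_mod)
    (auto simp: cong_mod_p_mult[of n 1, simplified])

lemma ghost_cong_mod_last:
  assumes "\<And>i. i < n \<Longrightarrow> cong_mod 1 (x i) (y i)" "\<And>i. i < n \<Longrightarrow> v (y i) \<le> 1"
    and "cong_mod (Suc n) (ghost p n x) (ghost p n y)"
  shows "cong_mod 1 (x n) (y n)"
proof -
  have "cong_mod (Suc n) (ghost p n x - ghost_init p n x) (ghost p n y - ghost_init p n y)"
    by (intro cong_mod_diff ghost_init_cong_mod assms)
  then show ?thesis
    using cong_mod_p_mult[of n 1] by (simp add: ghost_eq_init)
qed

lemma ghost_cong_mod_inject:
  assumes "\<And>i. v (y i) \<le> 1" "\<And>n. cong_mod (Suc n) (ghost p n x) (ghost p n y)"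
  shows "cong_mod 1 (x i) (y i)"
proof (induction i rule: less_induct)
  case (less i)
  then show ?case using ghost_cong_mod_last[of i x y] assms by blast
qed

end

section \<open>Ghost components of Witt vectors over the tilt\<close>

lemma add_pow_int_hom:
  assumes "ring_hom_cring R S h" "x \<in> carrier R"
  shows "h (add_pow R (k :: int) x) = add_pow S k (h x)"
proof -
  interpret ring_hom_cring R S h by fact
  show ?thesis
    using group_hom.hom_int_pow[OF ring.a_group_hom, of x k] assms(2) by (simp add: add_pow_def)
qed

lemma mpoly_eval_hom:
  assumes "ring_hom_cring R S h" "\<And>i. f i \<in> carrier R"
  shows "h (mpoly_eval R f P) = mpoly_eval S (\<lambda>i. h (f i)) P"
proof -
  interpret ring_hom_cring R S h by fact
  have prod: "(\<Otimes>\<^bsub>R\<^esub>i\<in>A. f i [^]\<^bsub>R\<^esub> (e i :: nat)) \<in> carrier R" for A e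
    using assms(2) by (intro R.finprod_closed) auto
  have hprod: "h (\<Otimes>\<^bsub>R\<^esub>i\<in>A. f i [^]\<^bsub>R\<^esub> (e i :: nat)) = (\<Otimes>\<^bsub>S\<^esub>i\<in>A. h (f i) [^]\<^bsub>S\<^esub> e i)" for A e
    using assms(2) by (subst hom_finprod) (auto simp: Pi_def hom_pow intro!: S.finprod_cong')
  show ?thesis
    unfolding mpoly_eval_def
    by (subst hom_finsum)
      (auto simp: Pi_def prod hprod add_pow_int_hom[OF assms(1)] intro!: S.finsum_cong' R.add.int_pow_closed S.add.int_pow_closed S.finprod_closed S.nat_pow_closed hom_closed assms(2))
qed

lemma mpoly_eval_closed:
  assumes "cring R" "\<And>i. f i \<in> carrier R"
  shows "mpoly_eval R f P \<in> carrier R"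
proof -
  interpret cring R by fact
  show ?thesis
    unfolding mpoly_eval_def using assms(2)
    by (intro finsum_closed funcsetI add.int_pow_closed finprod_closed nat_pow_closed) auto
qed

lemma cring_frob_limit:
  fixes R (structure)
  assumes "cring R" "p > 0"
    and frob: "\<And>x y. x \<in> carrier R \<Longrightarrow> y \<in> carrier R \<Longrightarrow> (x \<oplus> y) [^] p = x [^] p \<oplus> y [^] p"
  shows "cring (frob_limit p R)"
proof -
  interpret cring R by fact
  have zero: "\<zero> [^] p = \<zero>"
    using assms(2) nat_pow_zero by simp
  have neg: "(\<ominus> x) [^] p = \<ominus> (x [^] p)" if x: "x \<in> carrier R" for x
    using frob[of "\<ominus> x" x] x by (intro minus_equality[symmetric]) (simp_all add: l_neg zero)
  show ?thesis
  proof (intro cringI abelian_groupI comm_monoidI)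
    fix x assume x: "x \<in> carrier (frob_limit p R)"
    show "\<exists>y\<in>carrier (frob_limit p R). y \<oplus>\<^bsub>frob_limit p R\<^esub> x = \<zero>\<^bsub>frob_limit p R\<^esub>"
      by (rule bexI[of _ "\<lambda>n. \<ominus> x n"]) (use x in \<open>auto simp: frob_limit_def neg l_neg\<close>)
  qed (auto simp: frob_limit_def frob zero nat_pow_distrib a_ac m_ac l_distr r_distr fun_eq_iff)
qed

context p_adic_abs
begin

definition residue :: "'k \<Rightarrow> 'k set"
  where "residue x = {y. cong_mod 1 y x}"

lemma carrier_OK [simp]: "x \<in> carrier (OK v) \<longleftrightarrow> v x \<le> 1"
  and mult_OK [simp]: "x \<otimes>\<^bsub>OK v\<^esub> y = x * y"
  and add_OK [simp]: "x \<oplus>\<^bsub>OK v\<^esub> y = x + y"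
  and one_OK [simp]: "\<one>\<^bsub>OK v\<^esub> = 1"
  and zero_OK [simp]: "\<zero>\<^bsub>OK v\<^esub> = 0"
  by (auto simp: OK_def ring_of_type_algebra_def)

lemma cring_OK: "cring (OK v)"
proof (intro cringI abelian_groupI comm_monoidI)
  fix x assume "x \<in> carrier (OK v)"
  then show "\<exists>y\<in>carrier (OK v). y \<oplus>\<^bsub>OK v\<^esub> x = \<zero>\<^bsub>OK v\<^esub>"
    by (intro bexI[of _ "- x"]) auto
qed (auto simp: v_add_le v_mult_le_one algebra_simps)

lemma PIdl_p_power: "PIdl\<^bsub>OK v\<^esub> (of_nat p ^ n) = {x. cong_mod n x 0}"
proof -
  have "v x \<le> 1 \<Longrightarrow> cong_mod n (x * of_nat p ^ n) 0" for x
    using cong_mod_p_mult[of n 0 x 0] by (simp add: cong_mod_def mult.commute)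
  moreover have "\<exists>y. x = y * of_nat p ^ n \<and> v y \<le> 1" if "cong_mod n x 0" for x
    using that p_gt_0 by (intro exI[of _ "x / of_nat p ^ n"])
      (auto simp: cong_mod_def v_divide v_p_power power_divide field_simps)
  ultimately show ?thesis
    by (auto simp: cgenideal_def)
qed

abbreviation p_ideal :: "'k set"
  where "p_ideal \<equiv> PIdl\<^bsub>OK v\<^esub> (of_nat p)"

abbreviation OK_p :: "'k set ring"
  where "OK_p \<equiv> OK v Quot p_ideal"

lemma ideal_p: "ideal p_ideal (OK v)"
  using cring.cgenideal_ideal[OF cring_OK] by simp

lemma coset_eq_residue [simp]: "p_ideal +>\<^bsub>OK v\<^esub> x = residue x"
proof -
  have "p_ideal +>\<^bsub>OK v\<^esub> x = {h + x | h. cong_mod 1 h 0}"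
    using PIdl_p_power[of 1] by (auto simp: a_r_coset_def')
  also have "\<dots> = residue x"
    unfolding residue_def cong_mod_def by (auto intro: exI[of _ "_ - x"])
  finally show ?thesis .
qed

lemma residue_hom: "ring_hom_cring (OK v) OK_p residue"
proof -
  have "(+>\<^bsub>OK v\<^esub>) p_ideal = residue" by (rule ext) simp
  then show ?thesis using ideal.rcos_ring_hom_cring[OF ideal_p cring_OK] by simp
qed

lemma cring_OK_p: "cring OK_p"
  using ideal.quotient_is_cring[OF ideal_p cring_OK] .

lemma carrier_OK_p: "U \<in> carrier OK_p \<longleftrightarrow> (\<exists>x. v x \<le> 1 \<and> U = residue x)"
  by (auto simp: FactRing_def A_RCOSETS_def')

lemma residue_self: "x \<in> residue x"
  by (simp add: residue_def)

lemma residue_eq_iff: "residue x = residue y \<longleftrightarrow> cong_mod 1 x y"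
  unfolding residue_def using cong_mod_sym cong_mod_trans cong_mod_refl by blast

lemma residue_memD:
  assumes "U \<in> carrier OK_p" "x \<in> U"
  shows "U = residue x" "v x \<le> 1"
proof -
  obtain y where y: "v y \<le> 1" "U = residue y" using assms carrier_OK_p by blast
  then have "cong_mod 1 x y" using assms by (simp add: residue_def)
  then show "U = residue x" "v x \<le> 1"
    using y residue_eq_iff v_le_one_cong cong_mod_sym by blast+
qed

lemma pow_OK: "x [^]\<^bsub>OK v\<^esub> (n :: nat) = x ^ n"
  by (induction n) (auto simp: nat_pow_def)

lemma mpoly_eval_OK:
  assumes "\<And>i. v (f i) \<le> 1"
  shows "mpoly_eval (OK v) f P = mpoly_ev f P"
proof -
  interpret cring "OK v" by (rule cring_OK)
  have prod: "(\<Otimes>\<^bsub>OK v\<^esub>i\<in>A. g i) = prod g A" if "finite A" "\<And>i. v (g i) \<le> 1" for A and g :: "'b \<Rightarrow> 'k"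
    using that by (induction A rule: finite_induct) (auto simp: finprod_insert)
  have sum: "(\<Oplus>\<^bsub>OK v\<^esub>i\<in>A. g i) = sum g A" if "finite A" "\<And>i. v (g i) \<le> 1" for A and g :: "'c \<Rightarrow> 'k"
    using that by (induction A rule: finite_induct) (auto simp: finsum_insert)
  have nat: "add_pow (OK v) (n :: nat) x = of_nat n * x" if "v x \<le> 1" for x n
    by (induction n) (auto simp: algebra_simps that)
  have neg: "\<ominus>\<^bsub>OK v\<^esub> x = - x" if "v x \<le> 1" for x
    using that by (intro minus_equality) auto
  have int: "add_pow (OK v) (n :: int) x = of_int n * x" if "v x \<le> 1" for x n
  proof (cases "n \<ge> 0")
    case True
    then show ?thesis using that by (simp add: add_pow_int_ge nat)
  next
    case False
    then show ?thesis
      using that by (simp add: add_pow_int_lt nat neg v_mult_le_one)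
  qed
  have mono: "(\<Otimes>\<^bsub>OK v\<^esub>i\<in>Poly_Mapping.keys m. f i [^]\<^bsub>OK v\<^esub> Poly_Mapping.lookup m i) = mono_ev f m" for m
    unfolding mono_ev_def pow_OK by (rule prod) (auto simp: assms v_power_le_one)
  have v_mono: "v (mono_ev f m) \<le> 1" for m
    using v_mpoly_ev_le_one[of f "Poly_Mapping.single m 1"] assms by simp
  show ?thesis
    unfolding mpoly_eval_def mpoly_ev_def mono int[OF v_mono]
    by (rule sum) (auto intro: v_mult_le_one v_mono)
qed

abbreviation tilt :: "(nat \<Rightarrow> 'k set) ring"
  where "tilt \<equiv> OK_flat p v"

lemma residue_pow:
  assumes "v x \<le> 1"
  shows "residue x [^]\<^bsub>OK_p\<^esub> (n :: nat) = residue (x ^ n)"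
proof -
  interpret ring_hom_cring "OK v" OK_p residue by (rule residue_hom)
  show ?thesis using ring.hom_nat_pow[of x n] assms by (simp add: pow_OK)
qed

lemma residue_add: "v x \<le> 1 \<Longrightarrow> v y \<le> 1 \<Longrightarrow> residue x \<oplus>\<^bsub>OK_p\<^esub> residue y = residue (x + y)"
  using ring_hom_add[OF ring_hom_cring.homh[OF residue_hom], of x y] by simp

lemma cring_tilt: "cring tilt"
  unfolding OK_flat_def
proof (rule cring_frob_limit[OF cring_OK_p p_gt_0])
  fix U V assume "U \<in> carrier OK_p" "V \<in> carrier OK_p"
  then obtain x y where xy: "v x \<le> 1" "U = residue x" "v y \<le> 1" "V = residue y"
    using carrier_OK_p by auto
  define r where "r = (\<Sum>i\<in>{1..<p}. of_nat ((p choose i) div p) * x ^ (i - 1) * y ^ (p - i))"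
  have "v (x * r) \<le> 1"
    unfolding r_def by (intro v_sum_le v_mult_le_one v_power_le_one) (use xy in auto)
  then have "cong_mod 1 (of_nat p * (x * r)) (of_nat p * 0)"
    using cong_mod_p_mult[of 1 0 "x * r" 0] by (simp add: cong_mod_def)
  then have "cong_mod 1 (x ^ p + y ^ p + of_nat p * (x * r)) (x ^ p + y ^ p + 0)"
    by (intro cong_mod_add) auto
  then have "cong_mod 1 ((x + y) ^ p) (x ^ p + y ^ p)"
    using prime_power_add[OF prime, of x y] by (simp only: r_def add_0_right)
  then show "(U \<oplus>\<^bsub>OK_p\<^esub> V) [^]\<^bsub>OK_p\<^esub> p = U [^]\<^bsub>OK_p\<^esub> p \<oplus>\<^bsub>OK_p\<^esub> V [^]\<^bsub>OK_p\<^esub> p"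
    by (simp add: xy residue_pow residue_add v_add_le v_power_le_one residue_eq_iff)
qed

lemma tilt_proj_hom: "ring_hom_cring tilt OK_p (\<lambda>x. x N)"
  by (rule UnivPoly.ring_hom_cringI[OF cring_tilt cring_OK_p], rule ring_hom_memI)
    (auto simp: OK_flat_def frob_limit_def)

lemma tilt_carrierD:
  assumes "x \<in> carrier tilt"
  shows "x n \<in> carrier OK_p" "x (Suc n) [^]\<^bsub>OK_p\<^esub> p = x n"
  using assms by (auto simp: OK_flat_def frob_limit_def)

lemma tilt_ex_rep:
  assumes "x \<in> carrier tilt"
  shows "\<exists>y. y \<in> x n"
  using tilt_carrierD(1)[OF assms] carrier_OK_p residue_self by blast

lemma tilt_memD:
  assumes "x \<in> carrier tilt" "y \<in> x n"
  shows "x n = residue y" "v y \<le> 1"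
  using residue_memD[OF tilt_carrierD(1)[OF assms(1)] assms(2)] by auto

lemma tilt_pow_mem:
  assumes "x \<in> carrier tilt" "y \<in> x (Suc n)"
  shows "y ^ p \<in> x n"
  using tilt_memD[OF assms] tilt_carrierD(2)[OF assms(1), of n] residue_pow[of y p] residue_self[of "y ^ p"]
  by simp

lemma mpoly_eval_tilt:
  assumes "\<And>i. f i \<in> carrier tilt" "\<And>i. y i \<in> f i N"
  shows "mpoly_ev y P \<in> mpoly_eval tilt f P N"
proof -
  have y: "f i N = residue (y i)" "v (y i) \<le> 1" for i
    using tilt_memD[OF assms(1) assms(2)] by auto
  have "mpoly_eval tilt f P N = mpoly_eval OK_p (\<lambda>i. f i N) P"
    by (rule mpoly_eval_hom[OF tilt_proj_hom]) (rule assms)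
  also have "\<dots> = residue (mpoly_eval (OK v) y P)"
    by (subst mpoly_eval_hom[OF residue_hom]) (auto simp: y)
  finally show ?thesis
    by (simp add: mpoly_eval_OK y(2) residue_self)
qed

definition lifts :: "nat \<Rightarrow> (nat \<Rightarrow> nat \<Rightarrow> 'k set) \<Rightarrow> (nat \<Rightarrow> 'k) \<Rightarrow> bool"
  where "lifts N x y \<longleftrightarrow> (\<forall>i. y i \<in> x i N)"

abbreviation A_inf :: "(nat \<Rightarrow> nat \<Rightarrow> 'k set) ring"
  where "A_inf \<equiv> Ainf p v"

lemma carrier_A_inf: "x \<in> carrier A_inf \<longleftrightarrow> (\<forall>i. x i \<in> carrier tilt)"
  by (simp add: Ainf_def witt_def)

lemma lifts_ex: "x \<in> carrier A_inf \<Longrightarrow> \<exists>y. lifts N x y"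
  unfolding lifts_def carrier_A_inf by (intro choice allI tilt_ex_rep) simp

lemma lifts_v: "x \<in> carrier A_inf \<Longrightarrow> lifts N x y \<Longrightarrow> v (y i) \<le> 1"
  unfolding lifts_def carrier_A_inf using tilt_memD(2)[of "x i" "y i" N] by simp

text \<open>The \<open>m\<close>-th ghost component of the projection of \<open>x\<close> to \<open>W(\<O>\<^sub>K/p)\<close> at level \<open>N\<close> of the tilt
  is defined modulo \<open>p\<^sup>m\<^sup>+\<^sup>1\<close>.\<close>

definition has_ghost :: "nat \<Rightarrow> nat \<Rightarrow> (nat \<Rightarrow> nat \<Rightarrow> 'k set) \<Rightarrow> 'k \<Rightarrow> bool"
  where "has_ghost N m x g \<longleftrightarrow> (\<exists>y. lifts N x y \<and> cong_mod (Suc m) g (ghost p m y))"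

lemma lifts_unique:
  assumes "x \<in> carrier A_inf" "lifts N x y" "lifts N x y'"
  shows "cong_mod 1 (y i) (y' i)"
proof -
  have "x i \<in> carrier tilt" "y i \<in> x i N" "y' i \<in> x i N"
    using assms by (auto simp: carrier_A_inf lifts_def)
  then have "residue (y i) = residue (y' i)"
    using tilt_memD(1)[of "x i" _ N] by simp
  then show ?thesis by (simp add: residue_eq_iff)
qed

lemma has_ghost_lifts:
  assumes "x \<in> carrier A_inf" "lifts N x y" "has_ghost N m x g"
  shows "cong_mod (Suc m) g (ghost p m y)"
proof -
  obtain y' where y': "lifts N x y'" "cong_mod (Suc m) g (ghost p m y')"
    using assms by (auto simp: has_ghost_def)
  have "cong_mod (Suc m) (ghost p m y') (ghost p m y)"
    by (intro ghost_cong_mod lifts_unique[OF assms(1) y'(1) assms(2)] lifts_v[OF assms(1,2)])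
  then show ?thesis using y' cong_mod_trans by blast
qed

lemma has_ghost_unique:
  assumes "x \<in> carrier A_inf" "has_ghost N m x g" "has_ghost N m x g'"
  shows "cong_mod (Suc m) g g'"
  by (meson assms cong_mod_sym cong_mod_trans has_ghost_def has_ghost_lifts)

lemma A_inf_eqI:
  assumes "x \<in> carrier A_inf" "x' \<in> carrier A_inf"
    and "\<And>N m. \<exists>g. has_ghost N m x g \<and> has_ghost N m x' g"
  shows "x = x'"
proof (intro ext)
  fix i N
  obtain y y' where y: "lifts N x y" "lifts N x' y'"
    using lifts_ex assms by blast
  have "cong_mod (Suc m) (ghost p m y) (ghost p m y')" for m
    using assms(3)[of N m] has_ghost_lifts[OF assms(1) y(1)] has_ghost_lifts[OF assms(2) y(2)]
    by (meson cong_mod_sym cong_mod_trans)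
  then have "cong_mod 1 (y i) (y' i)"
    using lifts_v[OF assms(2) y(2)] by (rule_tac ghost_cong_mod_inject)
  moreover have "x i N = residue (y i)" "x' i N = residue (y' i)"
    using assms y tilt_memD(1)[of "x i" "y i" N] tilt_memD(1)[of "x' i" "y' i" N]
    by (auto simp: lifts_def carrier_A_inf)
  ultimately show "x i N = x' i N"
    by (simp add: residue_eq_iff)
qed

lemma case_sum_tilt:
  assumes "x \<in> carrier A_inf" "x' \<in> carrier A_inf"
  shows "case_sum x x' i \<in> carrier tilt"
  using assms by (cases i) (auto simp: carrier_A_inf)

lemma A_inf_add_closed: "x \<in> carrier A_inf \<Longrightarrow> x' \<in> carrier A_inf \<Longrightarrow> x \<oplus>\<^bsub>A_inf\<^esub> x' \<in> carrier A_inf"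
  and A_inf_mult_closed: "x \<in> carrier A_inf \<Longrightarrow> x' \<in> carrier A_inf \<Longrightarrow> x \<otimes>\<^bsub>A_inf\<^esub> x' \<in> carrier A_inf"
  using mpoly_eval_closed[OF cring_tilt case_sum_tilt] by (auto simp: carrier_A_inf Ainf_def witt_def)

lemma lifts_case_sum:
  assumes "lifts N x y" "lifts N x' y'"
  shows "case_sum y y' i \<in> case_sum x x' i N"
  using assms by (cases i) (auto simp: lifts_def)

lemma has_ghost_add:
  assumes x: "x \<in> carrier A_inf" "x' \<in> carrier A_inf" and g: "has_ghost N m x g" "has_ghost N m x' g'"
  shows "has_ghost N m (x \<oplus>\<^bsub>A_inf\<^esub> x') (g + g')"
proof -
  obtain y y' where y: "lifts N x y" "cong_mod (Suc m) g (ghost p m y)"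
      "lifts N x' y'" "cong_mod (Suc m) g' (ghost p m y')"
    using g by (auto simp: has_ghost_def)
  define z where "z i = mpoly_ev (case_sum y y') (witt_sum p i)" for i
  have "lifts N (x \<oplus>\<^bsub>A_inf\<^esub> x') z"
    unfolding lifts_def z_def
    using mpoly_eval_tilt[OF case_sum_tilt[OF x] lifts_case_sum[OF y(1,3)]] by (auto simp: Ainf_def witt_def)
  moreover have "ghost p m z = ghost p m y + ghost p m y'"
    using arg_cong[OF witt_sum_ghost[OF prime, of m], of "mpoly_ev (case_sum y y')"] by (simp add: z_def[abs_def])
  ultimately show ?thesis
    using cong_mod_add[OF y(2,4)] by (auto simp: has_ghost_def)
qed

lemma has_ghost_mult:
  assumes x: "x \<in> carrier A_inf" "x' \<in> carrier A_inf" and g: "has_ghost N m x g" "has_ghost N m x' g'"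
  shows "has_ghost N m (x \<otimes>\<^bsub>A_inf\<^esub> x') (g * g')"
proof -
  obtain y y' where y: "lifts N x y" "cong_mod (Suc m) g (ghost p m y)"
      "lifts N x' y'" "cong_mod (Suc m) g' (ghost p m y')"
    using g by (auto simp: has_ghost_def)
  define z where "z i = mpoly_ev (case_sum y y') (witt_prod p i)" for i
  have "lifts N (x \<otimes>\<^bsub>A_inf\<^esub> x') z"
    unfolding lifts_def z_def
    using mpoly_eval_tilt[OF case_sum_tilt[OF x] lifts_case_sum[OF y(1,3)]] by (auto simp: Ainf_def witt_def)
  moreover have "ghost p m z = ghost p m y * ghost p m y'"
    using arg_cong[OF witt_prod_ghost[OF prime, of m], of "mpoly_ev (case_sum y y')"] by (simp add: z_def[abs_def])
  moreover have "v (ghost p m y) \<le> 1" "v g' \<le> 1"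
    using v_ghost_le_one lifts_v[OF x(1) y(1)] lifts_v[OF x(2) y(3)] v_le_one_cong[OF y(4)] by auto
  ultimately show ?thesis
    using cong_mod_mult[OF y(2,4)] by (auto simp: has_ghost_def)
qed

lemma teich_closed: "a \<in> carrier tilt \<Longrightarrow> teich tilt a \<in> carrier A_inf"
proof -
  interpret cring tilt by (rule cring_tilt)
  show "a \<in> carrier tilt \<Longrightarrow> teich tilt a \<in> carrier A_inf"
    by (simp add: carrier_A_inf teich_def)
qed

lemma zero_mem_tilt_zero: "0 \<in> \<zero>\<^bsub>tilt\<^esub> N"
proof -
  interpret t: ring_hom_cring tilt OK_p "\<lambda>x. x N" by (rule tilt_proj_hom)
  interpret r: ring_hom_cring "OK v" OK_p residue by (rule residue_hom)
  have "\<zero>\<^bsub>tilt\<^esub> N = residue 0"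
    using t.ring.hom_zero r.ring.hom_zero by simp
  then show ?thesis using residue_self by simp
qed

lemma has_ghost_teich:
  assumes "r \<in> a N"
  shows "has_ghost N m (teich tilt a) (r ^ (p ^ m))"
proof -
  have "lifts N (teich tilt a) (\<lambda>i. if i = 0 then r else 0)"
    using assms zero_mem_tilt_zero by (simp add: lifts_def teich_def)
  moreover have "ghost p m (\<lambda>i. if i = 0 then r else 0) = r ^ (p ^ m)"
  proof -
    have "ghost p m (\<lambda>i. if i = 0 then r else 0) = (\<Sum>i\<le>m. if i = 0 then r ^ (p ^ m) else 0)"
      unfolding ghost_def by (rule sum.cong) (use p_gt_0 in auto)
    then show ?thesis by simp
  qed
  ultimately show ?thesis
    unfolding has_ghost_def by (metis cong_mod_refl)
qed

lemma one_A_inf: "\<one>\<^bsub>A_inf\<^esub> = teich tilt \<one>\<^bsub>tilt\<^esub>"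
  by (simp add: Ainf_def witt_def)

lemma one_A_inf_closed: "\<one>\<^bsub>A_inf\<^esub> \<in> carrier A_inf"
  unfolding one_A_inf by (intro teich_closed) (meson cring.cring_simprules(6) cring_tilt)

lemma has_ghost_one: "has_ghost N m \<one>\<^bsub>A_inf\<^esub> 1"
proof -
  interpret t: ring_hom_cring tilt OK_p "\<lambda>x. x N" by (rule tilt_proj_hom)
  interpret r: ring_hom_cring "OK v" OK_p residue by (rule residue_hom)
  have "\<one>\<^bsub>tilt\<^esub> N = residue 1"
    using t.hom_one r.hom_one by simp
  then have "1 \<in> \<one>\<^bsub>tilt\<^esub> N" using residue_self by simp
  then show ?thesis
    using has_ghost_teich[of 1] by (simp add: one_A_inf)
qed

lemma zero_A_inf_closed: "\<zero>\<^bsub>A_inf\<^esub> \<in> carrier A_inf"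
proof -
  interpret cring tilt by (rule cring_tilt)
  show ?thesis by (simp add: Ainf_def witt_def)
qed

lemma has_ghost_zero: "has_ghost N m \<zero>\<^bsub>A_inf\<^esub> 0"
proof -
  have "lifts N \<zero>\<^bsub>A_inf\<^esub> (\<lambda>i. 0)"
    using zero_mem_tilt_zero by (simp add: lifts_def Ainf_def witt_def)
  moreover have "ghost p m (\<lambda>i. 0 :: 'k) = 0"
    unfolding ghost_def using p_gt_0 by (intro sum.neutral) auto
  ultimately show ?thesis
    unfolding has_ghost_def by (metis cong_mod_refl)
qed

lemma has_ghost_neg_ex:
  assumes x: "x \<in> carrier A_inf"
  obtains x' where "x' \<in> carrier A_inf" "\<And>N m g. has_ghost N m x g \<Longrightarrow> has_ghost N m x' (- g)"
proof -
  obtain s :: "nat \<Rightarrow> nat int_mpoly" where s: "\<And>n. ghost p n s = - ghost p n mvar"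
    using witt_neg_ghost_ex[OF prime] by blast
  define x' where "x' i = mpoly_eval tilt x (s i)" for i
  have "x' \<in> carrier A_inf"
    using mpoly_eval_closed[OF cring_tilt, of x] x by (simp add: carrier_A_inf x'_def)
  moreover have "has_ghost N m x' (- g)" if "has_ghost N m x g" for N m g
  proof -
    obtain y where y: "lifts N x y" "cong_mod (Suc m) g (ghost p m y)"
      using \<open>has_ghost N m x g\<close> by (auto simp: has_ghost_def)
    define z where "z i = mpoly_ev y (s i)" for i
    have "lifts N x' z"
      unfolding lifts_def z_def x'_def
      by (intro allI mpoly_eval_tilt) (use x y in \<open>auto simp: carrier_A_inf lifts_def\<close>)
    moreover have "ghost p m z = - ghost p m y"
      using arg_cong[OF s[of m], of "mpoly_ev y"] by (simp add: z_def[abs_def])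
    ultimately show ?thesis
      using cong_mod_minus[OF y(2)] by (auto simp: has_ghost_def)
  qed
  ultimately show ?thesis by (rule that)
qed

lemma has_ghost_ex: "x \<in> carrier A_inf \<Longrightarrow> \<exists>g. has_ghost N m x g"
  unfolding has_ghost_def using lifts_ex cong_mod_refl by blast

lemma
  assumes x: "x \<in> carrier A_inf"
  shows a_inv_A_inf_closed: "\<ominus>\<^bsub>A_inf\<^esub> x \<in> carrier A_inf"
    and has_ghost_a_inv: "has_ghost N m x g \<Longrightarrow> has_ghost N m (\<ominus>\<^bsub>A_inf\<^esub> x) (- g)"
proof -
  obtain x' where x': "x' \<in> carrier A_inf" "\<And>N m g. has_ghost N m x g \<Longrightarrow> has_ghost N m x' (- g)"
    using has_ghost_neg_ex[OF x] by blast
  have "\<ominus>\<^bsub>A_inf\<^esub> x = x'"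
    unfolding a_inv_def m_inv_def
  proof (rule the_equality, simp_all, intro conjI)
    show "x' \<in> carrier A_inf" by fact
    have "\<exists>g. has_ghost N m (x \<oplus>\<^bsub>A_inf\<^esub> x') g \<and> has_ghost N m \<zero>\<^bsub>A_inf\<^esub> g" for N m
      using has_ghost_ex[OF x, of N m] has_ghost_add[OF x x'(1) _ x'(2)] has_ghost_zero
      by (metis add.right_inverse)
    then show "x \<oplus>\<^bsub>A_inf\<^esub> x' = \<zero>\<^bsub>A_inf\<^esub>"
      by (intro A_inf_eqI A_inf_add_closed zero_A_inf_closed x x')
    have "\<exists>g. has_ghost N m (x' \<oplus>\<^bsub>A_inf\<^esub> x) g \<and> has_ghost N m \<zero>\<^bsub>A_inf\<^esub> g" for N m
      using has_ghost_ex[OF x, of N m] has_ghost_add[OF x'(1) x x'(2)] has_ghost_zero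
      by (metis add.left_inverse)
    then show "x' \<oplus>\<^bsub>A_inf\<^esub> x = \<zero>\<^bsub>A_inf\<^esub>"
      by (intro A_inf_eqI A_inf_add_closed zero_A_inf_closed x x')
  next
    fix y assume y: "y \<in> carrier A_inf \<and> x \<oplus>\<^bsub>A_inf\<^esub> y = \<zero>\<^bsub>A_inf\<^esub> \<and> y \<oplus>\<^bsub>A_inf\<^esub> x = \<zero>\<^bsub>A_inf\<^esub>"
    show "y = x'"
    proof (rule A_inf_eqI)
      fix N m
      obtain g h where gh: "has_ghost N m x g" "has_ghost N m y h"
        using has_ghost_ex x y by blast
      have "has_ghost N m \<zero>\<^bsub>A_inf\<^esub> (g + h)"
        using has_ghost_add[OF x _ gh] y by simp
      then have "cong_mod (Suc m) (g + h) 0"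
        by (rule has_ghost_unique[OF zero_A_inf_closed _ has_ghost_zero])
      then have "cong_mod (Suc m) (- g) h"
        using v_commute[of "g + h" 0] by (simp add: cong_mod_def)
      then have "has_ghost N m y (- g)"
        using gh(2) cong_mod_trans unfolding has_ghost_def by blast
      then show "\<exists>g. has_ghost N m y g \<and> has_ghost N m x' g"
        using x'(2) gh(1) by blast
    qed (use y x' in auto)
  qed
  then show "\<ominus>\<^bsub>A_inf\<^esub> x \<in> carrier A_inf" "has_ghost N m x g \<Longrightarrow> has_ghost N m (\<ominus>\<^bsub>A_inf\<^esub> x) (- g)"
    using x' by auto
qed

lemma A_inf_minus_closed: "x \<in> carrier A_inf \<Longrightarrow> x' \<in> carrier A_inf \<Longrightarrow> x \<ominus>\<^bsub>A_inf\<^esub> x' \<in> carrier A_inf"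
  unfolding a_minus_def by (intro A_inf_add_closed a_inv_A_inf_closed)

lemma has_ghost_minus:
  assumes "x \<in> carrier A_inf" "x' \<in> carrier A_inf" "has_ghost N m x g" "has_ghost N m x' g'"
  shows "has_ghost N m (x \<ominus>\<^bsub>A_inf\<^esub> x') (g - g')"
  using has_ghost_add[OF assms(1) a_inv_A_inf_closed assms(3) has_ghost_a_inv] assms
  unfolding a_minus_def by fastforce

lemma
  shows nat_A_inf_closed: "add_pow A_inf (n :: nat) \<one>\<^bsub>A_inf\<^esub> \<in> carrier A_inf"
    and has_ghost_nat: "has_ghost N m (add_pow A_inf (n :: nat) \<one>\<^bsub>A_inf\<^esub>) (of_nat n)"
proof -
  have "add_pow A_inf (n :: nat) \<one>\<^bsub>A_inf\<^esub> \<in> carrier A_inf \<and> has_ghost N m (add_pow A_inf (n :: nat) \<one>\<^bsub>A_inf\<^esub>) (of_nat n)"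
  proof (induction n)
    case 0
    then show ?case
      by (simp add: add_pow_def nat_pow_def zero_A_inf_closed has_ghost_zero)
  next
    case (Suc n)
    have "add_pow A_inf (Suc n) \<one>\<^bsub>A_inf\<^esub> = add_pow A_inf n \<one>\<^bsub>A_inf\<^esub> \<oplus>\<^bsub>A_inf\<^esub> \<one>\<^bsub>A_inf\<^esub>"
      by (simp add: add_pow_def nat_pow_def)
    then show ?case
      using Suc A_inf_add_closed[OF _ one_A_inf_closed] has_ghost_add[OF _ one_A_inf_closed _ has_ghost_one]
      by (simp add: add.commute[of 1])
  qed
  then show "add_pow A_inf n \<one>\<^bsub>A_inf\<^esub> \<in> carrier A_inf" "has_ghost N m (add_pow A_inf n \<one>\<^bsub>A_inf\<^esub>) (of_nat n)"
    by auto
qed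

end

section \<open>Approximating theta\<close>

locale complete_p_adic_abs = p_adic_abs p v for p :: nat and v :: "'k::field_char_0 \<Rightarrow> real" +
  assumes complete: "Metric_space.mcomplete UNIV (vdist v)"
begin

sublocale Metric_space UNIV "vdist v"
proof
  fix x y z
  show "vdist v x z \<le> vdist v x y + vdist v y z"
    using v_add_le[of "x - y" "v (x - y) + v (y - z)" "y - z"]
    unfolding vdist_def by simp
qed (auto simp: vdist_def v_commute)

lemma vtendsto_iff: "vtendsto v s l \<longleftrightarrow> (\<forall>e>0. \<exists>N. \<forall>n\<ge>N. v (s n - l) < e)"
  by (simp add: vtendsto_def limit_metric_sequentially vdist_def)

lemma vtendsto_unique: "vtendsto v s l \<Longrightarrow> vtendsto v s l' \<Longrightarrow> l = l'"
  unfolding vtendsto_def by (rule limitin_metric_unique) auto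

lemma ex_p_power_less:
  assumes "e > 0"
  shows "\<exists>n. (1 / real p) ^ n < e"
  using assms p_gt_1 by (intro real_arch_pow_inv) auto

lemma vtendsto_cong_mod:
  assumes "vtendsto v s l" "\<And>j. cong_mod j (s' j) (s j)"
  shows "vtendsto v s' l"
  unfolding vtendsto_iff
proof (intro allI impI)
  fix e :: real assume e: "e > 0"
  obtain N where N: "\<And>n. n \<ge> N \<Longrightarrow> v (s n - l) < e"
    using assms(1) e unfolding vtendsto_iff by blast
  obtain M where M: "(1 / real p) ^ M < e"
    using ex_p_power_less[OF e] by blast
  have "v (s' n - l) < e" if "n \<ge> max N M" for n
  proof -
    have "v (s' n - s n) < e"
      using cong_mod_mono[OF assms(2), of M n] that M by (simp add: cong_mod_def)
    then show ?thesis
      using v_add[of "s' n - s n" "s n - l"] N[of n] that by simp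
  qed
  then show "\<exists>N. \<forall>n\<ge>N. v (s' n - l) < e" by blast
qed

lemma ex_limit:
  assumes "\<And>j. cong_mod (c + j) (s (Suc j)) (s j)"
  shows "\<exists>l. vtendsto v s l \<and> (\<forall>j. cong_mod (c + j) l (s j))"
proof -
  have step: "cong_mod (c + j) (s (j + k)) (s j)" for j k
  proof (induction k)
    case (Suc k)
    have "cong_mod (c + j) (s (Suc (j + k))) (s (j + k))"
      by (rule cong_mod_mono[OF assms]) simp
    then show ?case using Suc cong_mod_trans by simp
  qed simp
  have "MCauchy s"
    unfolding MCauchy_def
  proof (intro conjI allI impI)
    fix e :: real assume "e > 0"
    then obtain N where N: "(1 / real p) ^ N < e"
      using ex_p_power_less by blast
    have "v (s n - s n') < e" if "N \<le> n" "N \<le> n'" for n n'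
    proof -
      have "cong_mod (c + N) (s n) (s N)" "cong_mod (c + N) (s n') (s N)"
        using step[of N "n - N"] step[of N "n' - N"] that by auto
      then have "cong_mod N (s n) (s n')"
        by (meson cong_mod_mono cong_mod_sym cong_mod_trans le_add2)
      then show ?thesis using N by (simp add: cong_mod_def)
    qed
    then show "\<exists>N. \<forall>n n'. N \<le> n \<longrightarrow> N \<le> n' \<longrightarrow> vdist v (s n) (s n') < e"
      unfolding vdist_def by blast
  qed simp
  then obtain l where l: "vtendsto v s l"
    using complete unfolding mcomplete_def vtendsto_def by blast
  have "cong_mod (c + j) l (s j)" for j
  proof -
    have "(1 / real p) ^ (c + j) > 0" using p_gt_0 by simp
    then obtain N where N: "\<And>n. n \<ge> N \<Longrightarrow> v (s n - l) < (1 / real p) ^ (c + j)"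
      using l unfolding vtendsto_iff by blast
    have "cong_mod (c + j) l (s (j + N))"
      using N[of "j + N"] v_commute[of l] by (simp add: cong_mod_def)
    then show ?thesis using step cong_mod_trans by blast
  qed
  then show ?thesis using l by blast
qed

lemma sharp_cong_mod:
  assumes x: "x \<in> carrier tilt" and z: "z \<in> x (n + j)"
  shows "cong_mod (Suc j) (sharp p v n x) (z ^ (p ^ j))"
proof -
  have "\<exists>y. \<forall>k. y k \<in> x k"
    by (intro choice allI tilt_ex_rep[OF x])
  then obtain y where y: "\<And>k. y k \<in> x k" by blast
  have cong: "cong_mod (Suc j) (y1 ^ (p ^ j)) (y2 ^ (p ^ j))" if "y1 \<in> x k" "y2 \<in> x k" for y1 y2 k j
  proof (rule cong_mod_power_prime_power)
    show "cong_mod (Suc 0) y1 y2" "v y2 \<le> 1"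
      using tilt_memD[OF x that(1)] tilt_memD[OF x that(2)] residue_eq_iff[of y1 y2] by auto
  qed
  define s where "s j = y (n + j) ^ (p ^ j)" for j
  have "cong_mod (1 + j) (s (Suc j)) (s j)" for j
    using cong[OF tilt_pow_mem[OF x y[of "Suc (n + j)"]] y[of "n + j"], of j]
    by (simp add: s_def mult.commute flip: power_mult)
  then obtain l where l: "vtendsto v s l" "\<And>j. cong_mod (1 + j) l (s j)"
    using ex_limit[of 1 s] by blast
  have "sharp p v n x = l"
    unfolding sharp_def
  proof (rule the_equality)
    show "\<forall>y. (\<forall>k. y k \<in> x k) \<longrightarrow> vtendsto v (\<lambda>j. y (n + j) ^ p ^ j) l"
    proof (intro allI impI)
      fix y' assume y': "\<forall>k. y' k \<in> x k"
      have "cong_mod j (y' (n + j) ^ p ^ j) (s j)" for j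
        unfolding s_def by (rule cong_mod_mono[OF cong]) (use y y' in auto)
      then show "vtendsto v (\<lambda>j. y' (n + j) ^ p ^ j) l"
        by (rule vtendsto_cong_mod[OF l(1)])
    qed
  next
    fix l' assume "\<forall>y. (\<forall>k. y k \<in> x k) \<longrightarrow> vtendsto v (\<lambda>j. y (n + j) ^ p ^ j) l'"
    then have "vtendsto v s l'" using y by (simp add: s_def[abs_def])
    then show "l' = l" using l(1) vtendsto_unique by blast
  qed
  then show ?thesis
    using l(2)[of j] cong[OF y z, of j] cong_mod_trans unfolding s_def by simp
qed

lemma theta_cong_mod:
  assumes A: "A \<in> carrier A_inf" and a: "lifts n A a"
  shows "cong_mod n (theta p v A) (ghost_init p n a)"
proof -
  define s where "s N = (\<Sum>i<N. of_nat p ^ i * sharp p v i (A i))" for N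
  have Ai: "A i \<in> carrier tilt" for i using A by (simp add: carrier_A_inf)
  have v_sharp: "v (sharp p v i (A i)) \<le> 1" for i
  proof -
    obtain z where "z \<in> A i i" using tilt_ex_rep[OF Ai] by blast
    then show ?thesis
      using sharp_cong_mod[OF Ai, of z i i 0] tilt_memD(2)[OF Ai, of z i i] v_le_one_cong by simp
  qed
  have "cong_mod (0 + N) (s (Suc N)) (s N)" for N
    using cong_mod_p_mult[of N 0 "sharp p v N (A N)" 0] v_sharp[of N]
    by (simp add: s_def cong_mod_def)
  then obtain l where l: "vtendsto v s l" "\<And>j. cong_mod (0 + j) l (s j)"
    using ex_limit[of 0 s] by blast
  have "theta p v A = l"
    unfolding theta_def vlim_def
    by (rule the_equality) (use l(1) vtendsto_unique in \<open>auto simp: s_def[abs_def]\<close>)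
  moreover have "cong_mod n (s n) (ghost_init p n a)"
    unfolding s_def ghost_init_def
  proof (rule cong_mod_sum)
    fix i assume i: "i \<in> {..<n}"
    have "cong_mod (Suc (n - i)) (sharp p v i (A i)) (a i ^ (p ^ (n - i)))"
      by (rule sharp_cong_mod[OF Ai]) (use a i in \<open>auto simp: lifts_def\<close>)
    then have "cong_mod (i + Suc (n - i)) (of_nat p ^ i * sharp p v i (A i))
        (of_nat p ^ i * a i ^ (p ^ (n - i)))"
      by (simp only: cong_mod_p_mult)
    then show "cong_mod n (of_nat p ^ i * sharp p v i (A i)) (of_nat p ^ i * a i ^ (p ^ (n - i)))"
      by (rule cong_mod_mono) (use i in auto)
  qed
  ultimately show ?thesis
    using l(2)[of n] cong_mod_trans by simp
qed

end

section \<open>The formal solution\<close>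

definition deg0_le :: "nat \<Rightarrow> nat int_mpoly \<Rightarrow> bool"
  where "deg0_le d P \<longleftrightarrow> (\<forall>m\<in>Poly_Mapping.keys P. Poly_Mapping.lookup m 0 \<le> d)"

lemma deg0_le_mono: "deg0_le d P \<Longrightarrow> d \<le> e \<Longrightarrow> deg0_le e P"
  by (force simp: deg0_le_def)

lemma deg0_le_add: "deg0_le d P \<Longrightarrow> deg0_le d Q \<Longrightarrow> deg0_le d (P + Q)"
  using Poly_Mapping.keys_add[of P Q] by (auto simp: deg0_le_def)

lemma deg0_le_diff: "deg0_le d P \<Longrightarrow> deg0_le d Q \<Longrightarrow> deg0_le d (P - Q)"
  using keys_diff[of P Q] by (auto simp: deg0_le_def)

lemma deg0_le_mult:
  assumes "deg0_le d P" "deg0_le e Q"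
  shows "deg0_le (d + e) (P * Q)"
  unfolding deg0_le_def
proof
  fix m assume "m \<in> Poly_Mapping.keys (P * Q)"
  then obtain k l where "m = k + l" "k \<in> Poly_Mapping.keys P" "l \<in> Poly_Mapping.keys Q"
    using keys_mult[of P Q] by blast
  then show "Poly_Mapping.lookup m 0 \<le> d + e"
    using assms by (auto simp: deg0_le_def lookup_add intro: add_mono)
qed

lemma deg0_le_one: "deg0_le d 1"
  by (simp add: deg0_le_def)

lemma deg0_le_zero: "deg0_le d 0"
  by (simp add: deg0_le_def)

lemma deg0_le_power: "deg0_le d P \<Longrightarrow> deg0_le (k * d) (P ^ k)"
  by (induction k) (auto intro: deg0_le_mult deg0_le_one)

lemma deg0_le_sum: "(\<And>i. i \<in> A \<Longrightarrow> deg0_le d (f i)) \<Longrightarrow> deg0_le d (sum f A)"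
  by (induction A rule: infinite_finite_induct) (auto intro: deg0_le_add deg0_le_zero)

lemma deg0_le_mvar: "deg0_le (if i = 0 then 1 else 0) (mvar i)"
  by (auto simp: deg0_le_def mvar_def lookup_single)

lemma deg0_le_of_nat_mult_iff: "k \<noteq> 0 \<Longrightarrow> deg0_le d (of_nat k * P) \<longleftrightarrow> deg0_le d P"
  by (simp add: deg0_le_def keys_of_nat_mult)

lemma generate_ring_fld:
  fixes H :: "'k::field_char_0 set"
  shows "1 \<in> generate_ring fld H" "0 \<in> generate_ring fld H"
    "x \<in> generate_ring fld H \<Longrightarrow> - x \<in> generate_ring fld H"
    "x \<in> generate_ring fld H \<Longrightarrow> y \<in> generate_ring fld H \<Longrightarrow> x + y \<in> generate_ring fld H"
    "x \<in> generate_ring fld H \<Longrightarrow> y \<in> generate_ring fld H \<Longrightarrow> x * y \<in> generate_ring fld H"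
proof -
  interpret cring "fld :: 'k ring" by (rule cring_from_type_algebra)
  have neg: "\<ominus>\<^bsub>fld\<^esub> x = - x" for x :: 'k
    by (rule minus_equality) (auto simp: ring_of_type_algebra_def)
  show one: "1 \<in> generate_ring fld H"
    using generate_ring.one[of fld H] by (simp add: ring_of_type_algebra_def)
  show minus: "x \<in> generate_ring fld H \<Longrightarrow> - x \<in> generate_ring fld H" for x
    using generate_ring.a_inv[of x fld H] by (simp add: neg)
  show add: "x \<in> generate_ring fld H \<Longrightarrow> y \<in> generate_ring fld H \<Longrightarrow> x + y \<in> generate_ring fld H" for x y
    using generate_ring.eng_add[of x fld H y] by (simp add: ring_of_type_algebra_def)
  show "x \<in> generate_ring fld H \<Longrightarrow> y \<in> generate_ring fld H \<Longrightarrow> x * y \<in> generate_ring fld H"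
    using generate_ring.eng_mult[of x fld H y] by (simp add: ring_of_type_algebra_def)
  show "0 \<in> generate_ring fld H"
    using add[OF one minus[OF one]] by simp
qed

lemma mpoly_ev_in_generate_ring:
  fixes q t s :: "'k::field_char_0"
  assumes "deg0_le d P" "q \<noteq> 0"
  shows "q ^ d * mpoly_ev (\<lambda>i. if i = 0 then 1 / q else if i = 1 then t else s) P
    \<in> generate_ring fld {q, t, s}"
proof -
  let ?G = "generate_ring fld {q, t, s}" and ?f = "\<lambda>i :: nat. if i = 0 then 1 / q else if i = 1 then t else s"
  have qts: "q \<in> ?G" "t \<in> ?G" "s \<in> ?G"
    by (auto intro: generate_ring.incl)
  have pow: "x ^ n \<in> ?G" if "x \<in> ?G" for x n
    by (induction n) (auto intro: generate_ring_fld that)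
  have prod: "prod g A \<in> ?G" if "\<And>i. i \<in> A \<Longrightarrow> g i \<in> ?G" for g :: "nat \<Rightarrow> 'k" and A
    using that by (induction A rule: infinite_finite_induct) (auto intro: generate_ring_fld)
  have sum: "sum g A \<in> ?G" if "\<And>i. i \<in> A \<Longrightarrow> g i \<in> ?G" for g :: "(nat \<Rightarrow>\<^sub>0 nat) \<Rightarrow> 'k" and A
    using that by (induction A rule: infinite_finite_induct) (auto intro: generate_ring_fld)
  have of_nat: "of_nat n \<in> ?G" for n
    by (induction n) (auto intro: generate_ring_fld)
  have of_int: "of_int c \<in> ?G" for c
    using generate_ring_fld(4)[OF of_nat generate_ring_fld(3)[OF of_nat]]
    by (cases c rule: int_diff_cases) simp
  have "q ^ d * (of_int c * mono_ev ?f m) \<in> ?G" if "Poly_Mapping.lookup m 0 \<le> d" for c m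
  proof -
    let ?K = "insert 0 (Poly_Mapping.keys m)"
    have "mono_ev ?f m = (\<Prod>i\<in>?K. ?f i ^ Poly_Mapping.lookup m i)"
      by (rule mono_ev_superset) auto
    also have "\<dots> = (1 / q) ^ Poly_Mapping.lookup m 0 * (\<Prod>i\<in>?K - {0}. ?f i ^ Poly_Mapping.lookup m i)"
      by (subst prod.remove[of _ 0]) auto
    finally have "q ^ d * (of_int c * mono_ev ?f m) =
        of_int c * (q ^ (d - Poly_Mapping.lookup m 0) * (\<Prod>i\<in>?K - {0}. ?f i ^ Poly_Mapping.lookup m i))"
      using that assms(2) by (simp add: power_diff power_divide)
    also have "\<dots> \<in> ?G"
      by (intro generate_ring_fld(5) of_int pow prod) (auto intro: qts)
    finally show ?thesis .
  qed
  then show ?thesis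
    using assms(1) unfolding mpoly_ev_def sum_distrib_left deg0_le_def by (intro sum) auto
qed

definition steinberg :: "nat \<Rightarrow> nat \<Rightarrow> nat int_mpoly"
  where "steinberg p n = mvar 1 ^ (p ^ n) + mvar 2 ^ (p ^ n) - 1"

text \<open>\<open>b\<close> is a formal version of \<open>[p\<^sup>\<flat>] A = u + V F A\<close> with \<open>u = [T\<^sup>\<flat>] + [S\<^sup>\<flat>] - 1\<close>. At level \<open>n\<close> of the
  tilt the variables \<open>0\<close>, \<open>1\<close>, \<open>2\<close> stand for \<open>1/p_rt (n - 1)\<close>, \<open>T_rt n\<close>, \<open>S_rt n\<close>. The junk exponent
  \<open>n - 1\<close> at \<open>n = 0\<close> is harmless because \<open>ghost_init p 0 b = 0\<close>.\<close>

definition approx :: "nat \<Rightarrow> (nat \<Rightarrow> nat int_mpoly) \<Rightarrow> bool"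
  where "approx p b \<longleftrightarrow>
    (\<forall>n. ghost p n b = steinberg p n + of_nat p * mvar 0 ^ (p ^ (n - 1)) * ghost_init p n b)"

lemma approx_ex:
  assumes p: "Factorial_Ring.prime p"
  shows "\<exists>b. approx p b"
  unfolding approx_def
proof (rule dwork[OF p])
  fix n and s :: "nat \<Rightarrow> nat int_mpoly"
  let ?Z = "\<lambda>n. of_nat p * mvar 0 ^ (p ^ (n - 1)) :: nat int_mpoly"
  let ?F = "\<lambda>n s. steinberg p n + ?Z n * ghost_init p n s"
  have st: "frob_lift p (steinberg p n) = steinberg p (Suc n)"
    by (simp add: steinberg_def frob_lift_def flip: power_mult)
  have "frob_lift p (?Z n * ghost_init p n s) = ?Z (Suc n) * frob_lift p (ghost_init p n s)"
  proof (cases n)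
    case 0
    then show ?thesis by (simp add: frob_lift_def ghost_init_def)
  next
    case (Suc k)
    then show ?thesis by (simp add: frob_lift_def flip: power_mult)
  qed
  then have "?F (Suc n) s - frob_lift p (?F n s) =
      ?Z (Suc n) * (ghost_init p (Suc n) s - frob_lift p (ghost_init p n s))"
    using st by (simp add: frob_lift_def right_diff_distrib)
  also have "ghost_init p (Suc n) s - frob_lift p (ghost_init p n s) =
      (ghost_init p (Suc n) s - frob_lift p (ghost p n s)) + of_nat p ^ n * frob_lift p (s n)"
    by (simp add: frob_lift_def ghost_eq_init[of p n s] del: mpoly_ev_ghost)
  finally have eq: "?F (Suc n) s - frob_lift p (?F n s) = of_nat p * (mvar 0 ^ (p ^ n) *
      ((ghost_init p (Suc n) s - frob_lift p (ghost p n s)) + of_nat p ^ n * frob_lift p (s n)))"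
    by (simp add: mult.assoc)
  have "of_nat p ^ n dvd ghost_init p (Suc n) s - frob_lift p (ghost p n s)"
    using ghost_init_frob_lift[OF p, of n s] by (rule power_le_dvd) simp
  then show "of_nat p ^ Suc n dvd ?F (Suc n) s - frob_lift p (?F n s)"
    unfolding eq power_Suc by (intro mult_dvd_mono[OF dvd_refl] dvd_mult dvd_add dvd_triv_left)
qed (metis ghost_init_cong)

lemma deg0_le_ghost_init:
  assumes "p > 0" "\<And>i. i < n \<Longrightarrow> deg0_le (i * p ^ (i - 1)) (b i)"
  shows "deg0_le ((n - 1) * p ^ (n - 1)) (ghost_init p n b)"
  unfolding ghost_init_def
proof (rule deg0_le_sum)
  fix i assume i: "i \<in> {..<n}"
  have "p ^ (n - i) * (i * p ^ (i - 1)) \<le> (n - 1) * p ^ (n - 1)"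
  proof (cases i)
    case (Suc k)
    then have "n - 1 = (n - i) + (i - 1)" using i by auto
    then have "p ^ (n - i) * (i * p ^ (i - 1)) = i * p ^ (n - 1)"
      by (simp add: power_add)
    moreover have "i * p ^ (n - 1) \<le> (n - 1) * p ^ (n - 1)"
      using i by (intro mult_right_mono) auto
    ultimately show ?thesis by (rule ord_eq_le_trans)
  qed simp
  moreover have "deg0_le (p ^ (n - i) * (i * p ^ (i - 1))) (b i ^ (p ^ (n - i)))"
    by (intro deg0_le_power assms) (use i in auto)
  ultimately have "deg0_le ((n - 1) * p ^ (n - 1)) (b i ^ (p ^ (n - i)))"
    by (rule deg0_le_mono[rotated])
  then show "deg0_le ((n - 1) * p ^ (n - 1)) (of_nat p ^ i * b i ^ (p ^ (n - i)))"
    using assms(1) deg0_le_of_nat_mult_iff[of "p ^ i"] by simp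
qed

lemma deg0_le_steinberg: "deg0_le d (steinberg p n)"
  unfolding steinberg_def using deg0_le_power[OF deg0_le_mvar[of 1]] deg0_le_power[OF deg0_le_mvar[of 2]]
  by (intro deg0_le_diff deg0_le_add deg0_le_one) (auto intro: deg0_le_mono)

lemma deg0_le_approx:
  assumes b: "approx p b" and p: "p > 0"
  shows "deg0_le (n * p ^ (n - 1)) (b n)"
proof (induction n rule: less_induct)
  case (less n)
  have init: "deg0_le ((n - 1) * p ^ (n - 1)) (ghost_init p n b)"
    by (rule deg0_le_ghost_init[OF p less])
  have eq: "of_nat (p ^ n) * b n =
      steinberg p n + of_nat p * (mvar 0 ^ (p ^ (n - 1)) * ghost_init p n b) - ghost_init p n b"
    using b unfolding approx_def ghost_eq_init by (simp add: algebra_simps)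
  have "deg0_le (n * p ^ (n - 1)) (of_nat (p ^ n) * b n)"
  proof (cases n)
    case 0
    then show ?thesis unfolding eq by (simp add: ghost_init_def deg0_le_steinberg)
  next
    case (Suc k)
    have "deg0_le (p ^ (n - 1) * 1) (mvar 0 ^ (p ^ (n - 1)))"
      using deg0_le_power[OF deg0_le_mvar[of 0]] by simp
    then have "deg0_le (p ^ (n - 1) * 1 + (n - 1) * p ^ (n - 1)) (mvar 0 ^ (p ^ (n - 1)) * ghost_init p n b)"
      by (rule deg0_le_mult[OF _ init])
    then have "deg0_le (n * p ^ (n - 1)) (mvar 0 ^ (p ^ (n - 1)) * ghost_init p n b)"
      using Suc by simp
    then show ?thesis
      unfolding eq using p init
      by (intro deg0_le_diff deg0_le_add deg0_le_steinberg)
        (auto simp: deg0_le_of_nat_mult_iff intro: deg0_le_mono)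
  qed
  then show ?case using p deg0_le_of_nat_mult_iff[of "p ^ n"] by simp
qed

text \<open>The pole order \<open>(n - 1) p\<^sup>n\<^sup>-\<^sup>1\<close> of the remainder \<open>h\<close> costs the factor \<open>p\<^sup>n\<^sup>-\<^sup>1\<close> at the values above, which
  \<open>p\<^sup>n\<close> absorbs; \<open>steinberg p n\<close> vanishes there. The cofactor \<open>G\<close> is a geometric sum.\<close>

lemma approx_ghost_init:
  assumes b: "approx p b" and p: "p > 0"
  shows "\<exists>G h. ghost_init p n b = steinberg p n * G + of_nat p ^ n * h \<and>
    deg0_le ((n - 1) * p ^ (n - 1)) h"
proof -
  define Z where "Z = (of_nat p * mvar 0 ^ (p ^ (n - 1)) :: nat int_mpoly)"
  define G where "G = (\<Sum>i<n. Z ^ i)"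
  define h where "h = mvar 0 ^ (n * p ^ (n - 1)) * ghost_init p n b - b n * G"
  have "ghost_init p n b + of_nat p ^ n * b n = steinberg p n + Z * ghost_init p n b"
    using b unfolding approx_def ghost_eq_init Z_def by simp
  then have "(1 - Z) * ghost_init p n b = steinberg p n - of_nat p ^ n * b n"
    by (simp add: algebra_simps)
  moreover have "1 - Z ^ n = (1 - Z) * G"
    unfolding G_def by (rule one_diff_power_eq)
  ultimately have "(1 - Z ^ n) * ghost_init p n b = (steinberg p n - of_nat p ^ n * b n) * G"
    by (simp add: mult_ac)
  moreover have "Z ^ n = of_nat p ^ n * mvar 0 ^ (n * p ^ (n - 1))"
    by (simp add: Z_def power_mult_distrib mult.commute flip: power_mult)
  ultimately have eq: "ghost_init p n b = steinberg p n * G + of_nat p ^ n * h"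
    by (simp add: h_def algebra_simps)
  have "deg0_le (i * p ^ (n - 1)) (Z ^ i)" for i
  proof -
    have "deg0_le (p ^ (n - 1)) Z"
      unfolding Z_def using p deg0_le_power[OF deg0_le_mvar[of 0], of "p ^ (n - 1)"]
      by (simp add: deg0_le_of_nat_mult_iff)
    then show ?thesis by (rule deg0_le_power)
  qed
  then have "deg0_le ((n - 1) * p ^ (n - 1)) G"
    unfolding G_def by (intro deg0_le_sum) (rule deg0_le_mono, auto intro: mult_right_mono)
  then have "deg0_le ((n - 1) * p ^ (n - 1)) (steinberg p n * G)"
    using deg0_le_mult[OF deg0_le_steinberg[of 0]] by simp
  moreover have "deg0_le ((n - 1) * p ^ (n - 1)) (ghost_init p n b)"
    by (intro deg0_le_ghost_init deg0_le_approx assms)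
  moreover have "of_nat (p ^ n) * h = ghost_init p n b - steinberg p n * G"
    using eq by simp
  ultimately have "deg0_le ((n - 1) * p ^ (n - 1)) (of_nat (p ^ n) * h)"
    by (simp only: deg0_le_diff)
  then show ?thesis
    using eq p deg0_le_of_nat_mult_iff[of "p ^ n"] by auto
qed

section \<open>Comparison with the formal solution\<close>

lemma ghost_init_scale: "ghost_init p n (\<lambda>j. c ^ (p ^ j) * x j) = c ^ (p ^ n) * ghost_init p n x"
  unfolding ghost_init_def sum_distrib_left
proof (rule sum.cong[OF refl])
  fix j assume "j \<in> {..<n}"
  then have "p ^ j * p ^ (n - j) = p ^ n"
    by (simp flip: power_add)
  then show "of_nat p ^ j * (c ^ p ^ j * x j) ^ p ^ (n - j) = c ^ p ^ n * (of_nat p ^ j * x j ^ p ^ (n - j))"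
    by (simp add: power_mult_distrib mult_ac flip: power_mult)
qed

lemma ghost_scale: "ghost p n (\<lambda>j. c ^ (p ^ j) * x j) = c ^ (p ^ n) * ghost p n x"
  unfolding ghost_eq_init ghost_init_scale by (simp add: algebra_simps)

context p_adic_abs
begin

lemma approx_cong_mod:
  fixes Q t s :: 'k and a x :: "nat \<Rightarrow> 'k"
  assumes Q: "Q ^ (p ^ n) = of_nat p"
    and a: "\<And>j. v (a j) \<le> 1"
    and a_eq: "\<And>m. m < n \<Longrightarrow>
      cong_mod (Suc m) (ghost p m a * (Q ^ (p ^ m) - of_nat p)) (t ^ (p ^ m) + s ^ (p ^ m) - 1)"
    and x_eq: "\<And>m. m < n \<Longrightarrow> ghost p m x = t ^ (p ^ m) + s ^ (p ^ m) - 1 +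
      of_nat p * (ghost_init p m x / Q ^ (p ^ m))"
  shows "cong_mod n (ghost_init p n a) (ghost_init p n x / of_nat p)"
proof -
  define y where "y j = x j / Q ^ (p ^ j)" for j
  define r where "r = v Q"
  have Q0: "Q \<noteq> 0" using Q p_gt_0 by (metis of_nat_eq_0_iff power_0_left power_eq_0_iff not_gr_zero)
  have r: "r ^ (p ^ n) = 1 / real p" "r > 0"
    using arg_cong[OF Q, of v] Q0 v_nonneg[of Q] by (auto simp: r_def v_power v_p order.strict_iff_order)
  have r1: "r \<le> 1"
  proof (rule ccontr)
    assume "\<not> r \<le> 1"
    then have "1 \<le> r ^ (p ^ n)" by simp
    then show False using r p_gt_1 by simp
  qed
  have v_Q: "v (Q ^ k) \<le> 1" for k
    using r1 by (simp add: r_def v_power_le_one)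
  have y_init: "ghost_init p m x / Q ^ (p ^ m) = ghost_init p m y" for m
    using ghost_init_scale[of p m Q y] Q0 by (simp add: y_def)
  have init: "cong_mod m (ghost_init p m y) (ghost_init p m a)"
    if "m \<le> n" and x: "\<And>j. j < m \<Longrightarrow> cong_mod 1 (x j) (Q ^ (p ^ j) * a j)" for m
  proof (cases m)
    case (Suc k)
    have "cong_mod 1 (y j ^ p) (a j ^ p)" if j: "j \<le> k" for j
    proof -
      have pj: "p ^ Suc j \<le> p ^ n"
        using j Suc \<open>m \<le> n\<close> p_gt_0 by (intro power_increasing) auto
      then have pj': "p ^ j \<le> p ^ n"
        using p_gt_0 by (metis le_trans mult_le_mono1 mult_1 power_Suc Suc_leI One_nat_def)
      have "(y j - a j) * Q ^ (p ^ j) = x j - Q ^ (p ^ j) * a j"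
        using Q0 by (simp add: y_def algebra_simps)
      then have "v (y j - a j) * r ^ (p ^ j) = v (x j - Q ^ (p ^ j) * a j)"
        by (metis r_def v_mult v_power)
      also have "\<dots> \<le> r ^ (p ^ n)"
        using x[of j] j Suc r by (simp add: cong_mod_def)
      also have "r ^ (p ^ n) = r ^ (p ^ n - p ^ j) * r ^ (p ^ j)"
        using pj' by (simp flip: power_add)
      finally have d: "v (y j - a j) \<le> r ^ (p ^ n - p ^ j)"
        using r(2) by simp
      then have d1: "v (y j - a j) \<le> 1"
        using power_le_one[of r "p ^ n - p ^ j"] r r1 by linarith
      have "p ^ n \<le> (p ^ n - p ^ j) * p"
      proof -
        have "2 * p ^ n \<le> p * p ^ n"
          using prime_ge_2_nat[OF prime] by (rule mult_le_mono1)
        moreover have "(p ^ n - p ^ j) * p = p * p ^ n - p ^ Suc j"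
          by (simp add: diff_mult_distrib2 mult.commute)
        ultimately show ?thesis using pj by linarith
      qed
      then have "r ^ ((p ^ n - p ^ j) * p) \<le> 1 / real p"
        using r r1 power_decreasing[of "p ^ n" "(p ^ n - p ^ j) * p" r] by simp
      moreover have "v (y j - a j) ^ p \<le> (r ^ (p ^ n - p ^ j)) ^ p"
        using d by (intro power_mono) auto
      ultimately have "v (y j - a j) ^ p \<le> 1 / real p"
        by (simp flip: power_mult)
      moreover have "v (y j - a j) / real p \<le> 1 / real p"
        using d1 by (intro divide_right_mono) auto
      ultimately show ?thesis
        using v_power_prime_diff[OF a d1] by (simp add: cong_mod_def)
    qed
    then show ?thesis
      unfolding Suc ghost_init_Suc by (intro ghost_cong_mod v_power_le_one a)
  qed (simp add: ghost_init_def)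
  have main: "j < n \<Longrightarrow> cong_mod 1 (x j) (Q ^ (p ^ j) * a j)" for j
  proof (induction j rule: less_induct)
    case (less m)
    have "cong_mod m (ghost_init p m y) (ghost_init p m a)"
      by (rule init) (use less in auto)
    then have "cong_mod (1 + m) (of_nat p ^ 1 * ghost_init p m y) (of_nat p ^ 1 * ghost_init p m a)"
      by (simp only: cong_mod_p_mult)
    then have 1: "cong_mod (Suc m) (of_nat p * ghost_init p m y) (of_nat p * ghost_init p m a)"
      by simp
    have "cong_mod (Suc m + 0) (of_nat p ^ Suc m * a m) (of_nat p ^ Suc m * 0)"
      unfolding cong_mod_p_mult using a by (simp add: cong_mod_def)
    then have 2: "cong_mod (Suc m) (of_nat p ^ Suc m * a m) 0"
      by simp
    let ?u = "t ^ (p ^ m) + s ^ (p ^ m) - 1"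
    have "ghost p m (\<lambda>j. Q ^ (p ^ j) * a j) =
        ghost p m a * (Q ^ (p ^ m) - of_nat p) + (of_nat p * ghost_init p m a + of_nat p ^ Suc m * a m)"
      unfolding ghost_scale by (simp add: ghost_eq_init algebra_simps)
    also have "cong_mod (Suc m) \<dots> (?u + (of_nat p * ghost_init p m y + 0))"
      by (intro cong_mod_add a_eq less 2 cong_mod_sym[OF 1])
    also have "?u + (of_nat p * ghost_init p m y + 0) = ghost p m x"
      using x_eq[OF less(2)] y_init by simp
    finally have "cong_mod (Suc m) (ghost p m x) (ghost p m (\<lambda>j. Q ^ (p ^ j) * a j))"
      by (rule cong_mod_sym)
    then show ?case
      using less by (intro ghost_cong_mod_last[of m x "\<lambda>j. Q ^ (p ^ j) * a j"] v_mult_le_one v_Q a) auto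
  qed
  have "cong_mod n (ghost_init p n a) (ghost_init p n y)"
    by (rule cong_mod_sym[OF init]) (use main in auto)
  then show ?thesis
    using y_init[of n] Q by simp
qed

end

context complete_p_adic_abs
begin

lemma flat_closed:
  assumes "\<And>n. v (r n) \<le> 1" "\<And>n. r (Suc n) ^ p = r n"
  shows "flat p v r \<in> carrier tilt"
  using assms by (auto simp: OK_flat_def frob_limit_def flat_def carrier_OK_p residue_pow)

lemma has_ghost_flat: "has_ghost N m (teich tilt (flat p v r)) (r N ^ (p ^ m))"
  by (rule has_ghost_teich) (simp add: flat_def residue_self)

lemma theta_approximation:
  fixes p_rt T_rt S_rt :: "nat \<Rightarrow> 'k"
  assumes rt: "\<And>n. v (p_rt n) \<le> 1" "\<And>n. p_rt (Suc n) ^ p = p_rt n"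
      "\<And>n. v (T_rt n) \<le> 1" "\<And>n. T_rt (Suc n) ^ p = T_rt n"
      "\<And>n. v (S_rt n) \<le> 1" "\<And>n. S_rt (Suc n) ^ p = S_rt n"
    and p_rt: "p_rt 0 = of_nat p" and TS: "T_rt 0 + S_rt 0 = 1"
    and A: "A \<in> carrier A_inf"
    and eq: "(teich tilt (flat p v T_rt) \<oplus>\<^bsub>A_inf\<^esub> teich tilt (flat p v S_rt)) \<ominus>\<^bsub>A_inf\<^esub> \<one>\<^bsub>A_inf\<^esub>
      = A \<otimes>\<^bsub>A_inf\<^esub> (teich tilt (flat p v p_rt) \<ominus>\<^bsub>A_inf\<^esub> [p] \<cdot>\<^bsub>A_inf\<^esub> \<one>\<^bsub>A_inf\<^esub>)"
    and n: "n \<ge> 1"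
  shows "\<exists>a\<in>generate_ring fld {p_rt (n - 1), T_rt n, S_rt n}. cong_mod n (theta p v A) a"
proof -
  have root: "r k ^ (p ^ k) = r 0" if "\<And>n. r (Suc n) ^ p = r n" for r :: "nat \<Rightarrow> 'k" and k
    by (induction k) (simp_all add: that power_mult)
  define Q q t s where "Q = p_rt n" and "q = p_rt (n - 1)" and "t = T_rt n" and "s = S_rt n"
  have Q: "Q ^ (p ^ n) = of_nat p" and q: "q ^ (p ^ (n - 1)) = of_nat p" and Qq: "Q ^ p = q"
    and ts: "t ^ (p ^ n) + s ^ (p ^ n) = 1"
    using root[of p_rt, OF rt(2)] root[of T_rt, OF rt(4)] root[of S_rt, OF rt(6)] TS p_rt rt(2)[of "n - 1"] n
    by (auto simp: Q_def q_def t_def s_def)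
  have q0: "q \<noteq> 0"
    using q p_gt_0 by (metis of_nat_eq_0_iff power_0_left power_eq_0_iff not_gr_zero)
  obtain a where a: "lifts n A a" using lifts_ex[OF A] by blast
  have flat: "teich tilt (flat p v T_rt) \<in> carrier A_inf" "teich tilt (flat p v S_rt) \<in> carrier A_inf"
      "teich tilt (flat p v p_rt) \<in> carrier A_inf"
    by (intro teich_closed flat_closed rt)+
  have a_eq: "cong_mod (Suc m) (ghost p m a * (Q ^ (p ^ m) - of_nat p)) (t ^ (p ^ m) + s ^ (p ^ m) - 1)" for m
  proof -
    have gA: "has_ghost n m A (ghost p m a)"
      using a by (auto simp: has_ghost_def)
    have gl: "has_ghost n m ((teich tilt (flat p v T_rt) \<oplus>\<^bsub>A_inf\<^esub> teich tilt (flat p v S_rt)) \<ominus>\<^bsub>A_inf\<^esub> \<one>\<^bsub>A_inf\<^esub>)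
        (t ^ (p ^ m) + s ^ (p ^ m) - 1)"
      unfolding t_def s_def
      by (intro has_ghost_minus has_ghost_add has_ghost_flat has_ghost_one A_inf_add_closed flat one_A_inf_closed)
    have gr: "has_ghost n m (A \<otimes>\<^bsub>A_inf\<^esub> (teich tilt (flat p v p_rt) \<ominus>\<^bsub>A_inf\<^esub> [p] \<cdot>\<^bsub>A_inf\<^esub> \<one>\<^bsub>A_inf\<^esub>))
        (ghost p m a * (Q ^ (p ^ m) - of_nat p))"
      unfolding Q_def
      by (intro has_ghost_mult has_ghost_minus has_ghost_flat has_ghost_nat A_inf_minus_closed
          nat_A_inf_closed flat A gA)
    show ?thesis
      by (rule has_ghost_unique[OF _ gr gl[unfolded eq]])
        (intro A_inf_mult_closed A_inf_minus_closed nat_A_inf_closed flat A)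
  qed
  obtain b where b: "approx p b" using approx_ex[OF prime] by blast
  let ?f = "\<lambda>i. if i = 0 then 1 / q else if i = 1 then t else s"
  define x where "x j = mpoly_ev ?f (b j)" for j
  have st: "mpoly_ev ?f (steinberg p m) = t ^ (p ^ m) + s ^ (p ^ m) - 1" for m
    by (simp add: steinberg_def)
  have init: "mpoly_ev ?f (ghost_init p m b) = ghost_init p m x" for m
    by (simp add: ghost_init_def x_def)
  have x_eq: "ghost p m x = t ^ (p ^ m) + s ^ (p ^ m) - 1 + of_nat p * (ghost_init p m x / Q ^ (p ^ m))" for m
  proof -
    have "mpoly_ev ?f (ghost p m b) =
        mpoly_ev ?f (steinberg p m + of_nat p * mvar 0 ^ (p ^ (m - 1)) * ghost_init p m b)"
      using b by (simp add: approx_def)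
    then have "ghost p m x = t ^ (p ^ m) + s ^ (p ^ m) - 1
        + of_nat p * (1 / q) ^ (p ^ (m - 1)) * ghost_init p m x"
      by (simp add: st init x_def[abs_def])
    moreover have "(1 / q) ^ (p ^ (m - 1)) * ghost_init p m x = ghost_init p m x / Q ^ (p ^ m)"
    proof (cases m)
      case (Suc k)
      then show ?thesis by (simp add: power_divide power_mult flip: Qq)
    qed (simp add: ghost_init_def)
    ultimately show ?thesis by (simp add: mult.assoc)
  qed
  have "cong_mod n (ghost_init p n a) (ghost_init p n x / of_nat p)"
    by (rule approx_cong_mod[OF Q lifts_v[OF A a] a_eq x_eq])
  then have "cong_mod n (theta p v A) (ghost_init p n x / of_nat p)"
    using theta_cong_mod[OF A a] cong_mod_trans by blast
  moreover have "ghost_init p n x / of_nat p \<in> generate_ring fld {q, t, s}"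
  proof -
    obtain G h where h: "ghost_init p n b = steinberg p n * G + of_nat p ^ n * h"
      "deg0_le ((n - 1) * p ^ (n - 1)) h"
      using approx_ghost_init[OF b p_gt_0] by blast
    have "ghost_init p n x = of_nat p ^ n * mpoly_ev ?f h"
      using arg_cong[OF h(1), of "mpoly_ev ?f"] ts by (simp add: init st)
    moreover have "of_nat p ^ n = of_nat p * q ^ ((n - 1) * p ^ (n - 1))"
    proof -
      have "q ^ ((n - 1) * p ^ (n - 1)) = of_nat p ^ (n - 1)"
        by (simp only: mult.commute[of "n - 1"] power_mult q)
      then show ?thesis using n by (cases n) simp_all
    qed
    ultimately have "ghost_init p n x / of_nat p = q ^ ((n - 1) * p ^ (n - 1)) * mpoly_ev ?f h"
      using p_gt_0 by simp
    then show ?thesis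
      using mpoly_ev_in_generate_ring[OF h(2) q0] by simp
  qed
  ultimately show ?thesis unfolding q_def t_def s_def by blast
qed

end

theorem proposition0p3:
  fixes p :: nat and v :: "'k::field_char_0 \<Rightarrow> real"
    and Qp K0 Kbar :: "'k set" and T S :: 'k
    and p_rt T_rt S_rt :: "nat \<Rightarrow> 'k"
    and A :: "nat \<Rightarrow> nat \<Rightarrow> 'k set"
  assumes "gauss_tower p v Qp K0 Kbar T"
    and "S = 1 - T"
    and "root_system p v Kbar (of_nat p) p_rt"
    and "root_system p v Kbar T T_rt"
    and "root_system p v Kbar S S_rt"
    and "A \<in> carrier (Ainf p v)"
    and "(teich (OK_flat p v) (flat p v T_rt) \<oplus>\<^bsub>Ainf p v\<^esub> teich (OK_flat p v) (flat p v S_rt))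
           \<ominus>\<^bsub>Ainf p v\<^esub> \<one>\<^bsub>Ainf p v\<^esub>
         = A \<otimes>\<^bsub>Ainf p v\<^esub>
             (teich (OK_flat p v) (flat p v p_rt) \<ominus>\<^bsub>Ainf p v\<^esub> [p] \<cdot>\<^bsub>Ainf p v\<^esub> \<one>\<^bsub>Ainf p v\<^esub>)"
  shows "\<exists>a :: nat \<Rightarrow> 'k. \<forall>n\<ge>1.
           a n \<in> generate_ring fld {p_rt (n - 1), T_rt n, S_rt n} \<and>
           theta p v A - a n \<in> PIdl\<^bsub>OK v\<^esub> (of_nat p ^ n)"
proof -
  interpret gauss_tower p v Qp K0 Kbar T by fact
  have "multiplicity (int p) (int p) = 1"
    using prime by (intro multiplicity_self) (auto dest: prime_gt_1_nat)
  then have "v (of_nat p) = 1 / real p"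
    using padic[of "int p"] prime_gt_0_nat[OF prime] by simp
  then interpret complete_p_adic_abs p v
    using prime abs K by unfold_locales (auto simp: completion_of_def)
  have "\<exists>a\<in>generate_ring fld {p_rt (n - 1), T_rt n, S_rt n}. cong_mod n (theta p v A) a"
    if "n \<ge> 1" for n
    by (rule theta_approximation[OF _ _ _ _ _ _ _ _ assms(6,7) that])
      (use assms(2-5) in \<open>auto simp: root_system_def\<close>)
  then obtain a where "\<forall>n\<ge>1. a n \<in> generate_ring fld {p_rt (n - 1), T_rt n, S_rt n} \<and>
      cong_mod n (theta p v A) (a n)"
    by metis
  then show ?thesis
    unfolding PIdl_p_power by (intro exI[of _ a]) (simp add: cong_mod_def)
qed

end
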